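(* Under the standing assumptions, suppose in addition that $P_{1,n+1}(a)$ is invertible. Then for every $z\in\mathbb C\setminus\{b\}$, \begin{align*} U^{(2n+1)}(z)=&\begin{pmatrix}\frac{1}{b-z}I_q&0_q\\0_q&I_q\end{pmatrix}\Bigg[\overrightarrow{\prod_{k=0}^{n}}\begin{pmatrix}I_q&\mathbf l_{k-1}\\0_q&I_q\end{pmatrix}\begin{pmatrix}I_q&0_q\\-(z-a)\mathbf m_k&I_q\end{pmatrix}\Bigg]\\ &\cdot\begin{pmatrix}I_q&-\Gamma_{1,n}(a)^{-1}\Theta_{1,n}(a)-(b-a)P_{1,n+1}(a)^{-1}Q_{1,n+1}(a)\\0_q&I_q\end{pmatrix}\begin{pmatrix}(b-z)I_q&0_q\\0_q&I_q\end{pmatrix}, \end{align*} where $\overrightarrow{\prod_{k=0}^{n}}A_k:=A_0A_1\cdots A_{n}$.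
   Context: Let $q,n\in\mathbb N$ and let $a<b$ be real numbers. All matrices are complex; $I_q$, $0_q$ are the $q\times q$ identity and zero matrices; for a matrix-valued function $F$, $F^*(\bar z)$ means $(F(\bar z))^*$. Let $s_0,\dots,s_{2n+1}$ be Hermitian $q\times q$ matrices and set $\widehat s_j:=-ab\,s_j+(a+b)s_{j+1}-s_{j+2}$. Define $H_{1,j}:=(s_{l+k})_{l,k=0}^j$, $H_{2,j}:=(\widehat s_{l+k})_{l,k=0}^{j}$, $K_{1,j}:=(bs_{l+k}-s_{l+k+1})_{l,k=0}^{j}$, $K_{2,j}:=(-as_{l+k}+s_{l+k+1})_{l,k=0}^j$. Standing assumption: $H_{1,n},H_{2,n-1},K_{1,n},K_{2,n}$ are positive definite. Let $T_0:=0_q$ and, for $j\ge1$, let $T_j$ be the $(j+1)\times(j+1)$ block matrix (blocks $q\times q$) with $I_q$ in block positions $(l+1,l)$, $l=0,\dots,j-1$, and $0_q$ elsewhere; $R_j(z):=(I_{(j+1)q}-zT_j)^{-1}$; $v_j:=\mathrm{col}(I_q,0_q,\dots,0_q)\in\mathbb C^{(j+1)q\times q}$. Let $u_{1,j}:=\mathrm{col}(0_q,-s_0,\dots,-s_{j-1})$, $u_{2,0}:=-(a+b)s_0+s_1$, $u_{2,j}:=\mathrm{col}(u_{2,0},-\widehat s_0,\dots,-\widehat s_{j-1})$, $\widetilde u_{1,j}:=\mathrm{col}(s_0,s_1-bs_0,\dots,s_j-bs_{j-1})$; for $j\ge1$, $Y_{1,j}:=\mathrm{col}(s_j,\dots,s_{2j-1})$,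 $Y_{2,j}:=\mathrm{col}(\widehat s_j,\dots,\widehat s_{2j-1})$, $\widetilde Y_{1,j}:=\mathrm{col}(bs_j-s_{j+1},\dots,bs_{2j-1}-s_{2j})$. Polynomials: $P_{2,0}:=I_q$, $Q_{2,0}(z):=-(u_{2,0}+zs_0)$, $\Gamma_{1,0}:=I_q$, $\Theta_{1,0}:=s_0$; for $j\ge1$: $P_{2,j}(z):=(-Y_{2,j}^*H_{2,j-1}^{-1},I_q)R_j(z)v_j$, $Q_{2,j}(z):=-(-Y_{2,j}^*H_{2,j-1}^{-1},I_q)R_j(z)(u_{2,j}+zv_js_0)$, $\Gamma_{1,j}(z):=(-\widetilde Y_{1,j}^*K_{1,j-1}^{-1},I_q)R_j(z)v_j$, $\Theta_{1,j}(z):=(-\widetilde Y_{1,j}^*K_{1,j-1}^{-1},I_q)R_j(z)\widetilde u_{1,j}$; for $1\le j\le n+1$: $P_{1,j}(z):=(-Y_{1,j}^*H_{1,j-1}^{-1},I_q)R_j(z)v_j$, $Q_{1,j}(z):=-(-Y_{1,j}^*H_{1,j-1}^{-1},I_q)R_j(z)u_{1,j}$. DSM parameters: $\lambda_j:=(u_{2,j}+av_js_0)^*R_j(a)^*H_{2,j}^{-1}R_j(a)(u_{2,j}+av_js_0)$, $\mu_j:=v_j^*R_j(a)^*K_{1,j}^{-1}R_j(a)v_j$; $\mathbf l_{-1}:=s_0$, $\mathbf l_0:=\lambda_0$, $\mathbf l_j:=\lambda_j-\lambda_{j-1}$ ($1\le j\le n-1$); $\mathbf m_0:=\mu_0$,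 $\mathbf m_j:=\mu_j-\mu_{j-1}$ ($1\le j\le n$). Resolvent matrix (odd case): $U^{(2n+1)}(z):=\begin{pmatrix}Q_{2,n}^*(\bar z)Q_{2,n}(a)^{*-1} & -Q_{1,n+1}^*(\bar z)P_{1,n+1}(a)^{*-1}\\ -(z-a)(b-z)P_{2,n}^*(\bar z)Q_{2,n}(a)^{*-1} & P_{1,n+1}^*(\bar z)P_{1,n+1}(a)^{*-1}\end{pmatrix}$, where $X^{*-1}:=(X^* )^{-1}$ (the invertibility of $\Gamma_{1,n}(a)$ and $Q_{2,n}(a)$ holds under the standing assumptions). *)

theory Defs
  imports "Jordan_Normal_Form.Schur_Decomposition"
begin

(* inverse of a square matrix (meaningful when the matrix is invertible) *)
definition minv :: "complex mat \<Rightarrow> complex mat" where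
  "minv A = (SOME B. B \<in> carrier_mat (dim_row A) (dim_row A) \<and>
                     A * B = 1\<^sub>m (dim_row A) \<and> B * A = 1\<^sub>m (dim_row A))"

definition hermitian :: "complex mat \<Rightarrow> bool" where
  "hermitian A \<longleftrightarrow> square_mat A \<and> mat_adjoint A = A"

definition pos_def :: "complex mat \<Rightarrow> bool" where
  "pos_def A \<longleftrightarrow> hermitian A \<and>
     (\<forall>v \<in> carrier_vec (dim_row A). v \<noteq> 0\<^sub>v (dim_row A) \<longrightarrow> 0 < Re ((A *\<^sub>v v) \<bullet>c v))"

definition block_mat :: "nat \<Rightarrow> nat \<Rightarrow> nat \<Rightarrow> (nat \<Rightarrow> nat \<Rightarrow> complex mat) \<Rightarrow> complex mat" where
  "block_mat q m k F = mat (m * q) (k * q) (\<lambda>(i, j). F (i div q) (j div q) $$ (i mod q, j mod q))"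

definition hcat :: "complex mat \<Rightarrow> complex mat \<Rightarrow> complex mat" where
  "hcat A B = mat (dim_row A) (dim_col A + dim_col B)
     (\<lambda>(i, j). if j < dim_col A then A $$ (i, j) else B $$ (i, j - dim_col A))"

abbreviation blk2 :: "complex mat \<Rightarrow> complex mat \<Rightarrow> complex mat \<Rightarrow> complex mat \<Rightarrow> complex mat" where
  "blk2 A B C D \<equiv> four_block_mat A B C D"

definition ordprod :: "nat \<Rightarrow> (nat \<Rightarrow> complex mat) \<Rightarrow> nat \<Rightarrow> complex mat" where
  "ordprod d A n = foldr (\<lambda>k M. A k * M) [0..<Suc n] (1\<^sub>m d)"

definition adj_at :: "(complex \<Rightarrow> complex mat) \<Rightarrow> complex \<Rightarrow> complex mat" where
  "adj_at F z = mat_adjoint (F (cnj z))"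

definition shat :: "real \<Rightarrow> real \<Rightarrow> (nat \<Rightarrow> complex mat) \<Rightarrow> nat \<Rightarrow> complex mat" where
  "shat a b s j = (- of_real (a * b)) \<cdot>\<^sub>m s j + of_real (a + b) \<cdot>\<^sub>m s (j + 1) - s (j + 2)"

definition H1 :: "nat \<Rightarrow> (nat \<Rightarrow> complex mat) \<Rightarrow> nat \<Rightarrow> complex mat" where
  "H1 q s j = block_mat q (j + 1) (j + 1) (\<lambda>l k. s (l + k))"

definition H2 :: "nat \<Rightarrow> real \<Rightarrow> real \<Rightarrow> (nat \<Rightarrow> complex mat) \<Rightarrow> nat \<Rightarrow> complex mat" where
  "H2 q a b s j = block_mat q (j + 1) (j + 1) (\<lambda>l k. shat a b s (l + k))"

definition K1 :: "nat \<Rightarrow> real \<Rightarrow> (nat \<Rightarrow> complex mat) \<Rightarrow> nat \<Rightarrow> complex mat" where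
  "K1 q b s j = block_mat q (j + 1) (j + 1) (\<lambda>l k. of_real b \<cdot>\<^sub>m s (l + k) - s (l + k + 1))"

definition K2 :: "nat \<Rightarrow> real \<Rightarrow> (nat \<Rightarrow> complex mat) \<Rightarrow> nat \<Rightarrow> complex mat" where
  "K2 q a s j = block_mat q (j + 1) (j + 1) (\<lambda>l k. (- of_real a) \<cdot>\<^sub>m s (l + k) + s (l + k + 1))"

definition Tm :: "nat \<Rightarrow> nat \<Rightarrow> complex mat" where
  "Tm q j = block_mat q (j + 1) (j + 1) (\<lambda>l k. if l = k + 1 then 1\<^sub>m q else 0\<^sub>m q q)"

definition Rm :: "nat \<Rightarrow> nat \<Rightarrow> complex \<Rightarrow> complex mat" where
  "Rm q j z = minv (1\<^sub>m ((j + 1) * q) - z \<cdot>\<^sub>m Tm q j)"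

definition vv :: "nat \<Rightarrow> nat \<Rightarrow> complex mat" where
  "vv q j = block_mat q (j + 1) 1 (\<lambda>l k. if l = 0 then 1\<^sub>m q else 0\<^sub>m q q)"

definition u1 :: "nat \<Rightarrow> (nat \<Rightarrow> complex mat) \<Rightarrow> nat \<Rightarrow> complex mat" where
  "u1 q s j = block_mat q (j + 1) 1 (\<lambda>l k. if l = 0 then 0\<^sub>m q q else - s (l - 1))"

definition u20 :: "real \<Rightarrow> real \<Rightarrow> (nat \<Rightarrow> complex mat) \<Rightarrow> complex mat" where
  "u20 a b s = (- of_real (a + b)) \<cdot>\<^sub>m s 0 + s 1"

definition u2 :: "nat \<Rightarrow> real \<Rightarrow> real \<Rightarrow> (nat \<Rightarrow> complex mat) \<Rightarrow> nat \<Rightarrow> complex mat" where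
  "u2 q a b s j = block_mat q (j + 1) 1
     (\<lambda>l k. if l = 0 then u20 a b s else - shat a b s (l - 1))"

definition ut1 :: "nat \<Rightarrow> real \<Rightarrow> (nat \<Rightarrow> complex mat) \<Rightarrow> nat \<Rightarrow> complex mat" where
  "ut1 q b s j = block_mat q (j + 1) 1
     (\<lambda>l k. if l = 0 then s 0 else s l - of_real b \<cdot>\<^sub>m s (l - 1))"

definition Y1 :: "nat \<Rightarrow> (nat \<Rightarrow> complex mat) \<Rightarrow> nat \<Rightarrow> complex mat" where
  "Y1 q s j = block_mat q j 1 (\<lambda>l k. s (j + l))"

definition Y2 :: "nat \<Rightarrow> real \<Rightarrow> real \<Rightarrow> (nat \<Rightarrow> complex mat) \<Rightarrow> nat \<Rightarrow> complex mat" where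
  "Y2 q a b s j = block_mat q j 1 (\<lambda>l k. shat a b s (j + l))"

definition Yt1 :: "nat \<Rightarrow> real \<Rightarrow> (nat \<Rightarrow> complex mat) \<Rightarrow> nat \<Rightarrow> complex mat" where
  "Yt1 q b s j = block_mat q j 1 (\<lambda>l k. of_real b \<cdot>\<^sub>m s (j + l) - s (j + l + 1))"

definition P2 :: "nat \<Rightarrow> real \<Rightarrow> real \<Rightarrow> (nat \<Rightarrow> complex mat) \<Rightarrow> nat \<Rightarrow> complex \<Rightarrow> complex mat" where
  "P2 q a b s j z = (if j = 0 then 1\<^sub>m q else
     hcat (- (mat_adjoint (Y2 q a b s j) * minv (H2 q a b s (j - 1)))) (1\<^sub>m q)
       * Rm q j z * vv q j)"

definition Q2 :: "nat \<Rightarrow> real \<Rightarrow> real \<Rightarrow> (nat \<Rightarrow> complex mat) \<Rightarrow> nat \<Rightarrow> complex \<Rightarrow> complex mat" where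
  "Q2 q a b s j z = (if j = 0 then - (u20 a b s + z \<cdot>\<^sub>m s 0) else
     - (hcat (- (mat_adjoint (Y2 q a b s j) * minv (H2 q a b s (j - 1)))) (1\<^sub>m q)
       * Rm q j z * (u2 q a b s j + z \<cdot>\<^sub>m (vv q j * s 0))))"

definition Gamma1 :: "nat \<Rightarrow> real \<Rightarrow> (nat \<Rightarrow> complex mat) \<Rightarrow> nat \<Rightarrow> complex \<Rightarrow> complex mat" where
  "Gamma1 q b s j z = (if j = 0 then 1\<^sub>m q else
     hcat (- (mat_adjoint (Yt1 q b s j) * minv (K1 q b s (j - 1)))) (1\<^sub>m q)
       * Rm q j z * vv q j)"

definition Theta1 :: "nat \<Rightarrow> real \<Rightarrow> (nat \<Rightarrow> complex mat) \<Rightarrow> nat \<Rightarrow> complex \<Rightarrow> complex mat" where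
  "Theta1 q b s j z = (if j = 0 then s 0 else
     hcat (- (mat_adjoint (Yt1 q b s j) * minv (K1 q b s (j - 1)))) (1\<^sub>m q)
       * Rm q j z * ut1 q b s j)"

(* P_{1,j}, Q_{1,j} for j >= 1 *)
definition P1 :: "nat \<Rightarrow> (nat \<Rightarrow> complex mat) \<Rightarrow> nat \<Rightarrow> complex \<Rightarrow> complex mat" where
  "P1 q s j z = hcat (- (mat_adjoint (Y1 q s j) * minv (H1 q s (j - 1)))) (1\<^sub>m q)
       * Rm q j z * vv q j"

definition Q1 :: "nat \<Rightarrow> (nat \<Rightarrow> complex mat) \<Rightarrow> nat \<Rightarrow> complex \<Rightarrow> complex mat" where
  "Q1 q s j z = - (hcat (- (mat_adjoint (Y1 q s j) * minv (H1 q s (j - 1)))) (1\<^sub>m q)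
       * Rm q j z * u1 q s j)"

definition lam :: "nat \<Rightarrow> real \<Rightarrow> real \<Rightarrow> (nat \<Rightarrow> complex mat) \<Rightarrow> nat \<Rightarrow> complex mat" where
  "lam q a b s j = (let w = u2 q a b s j + of_real a \<cdot>\<^sub>m (vv q j * s 0);
                        R = Rm q j (of_real a)
                    in mat_adjoint w * mat_adjoint R * minv (H2 q a b s j) * R * w)"

definition mu :: "nat \<Rightarrow> real \<Rightarrow> real \<Rightarrow> (nat \<Rightarrow> complex mat) \<Rightarrow> nat \<Rightarrow> complex mat" where
  "mu q a b s j = (let R = Rm q j (of_real a)
                   in mat_adjoint (vv q j) * mat_adjoint R * minv (K1 q b s j) * R * vv q j)"

(* lshift k = bold l_{k-1}:  bold l_{-1} = s_0, bold l_0 = lambda_0, bold l_j = lambda_j - lambda_{j-1} *)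
fun lshift :: "nat \<Rightarrow> real \<Rightarrow> real \<Rightarrow> (nat \<Rightarrow> complex mat) \<Rightarrow> nat \<Rightarrow> complex mat" where
  "lshift q a b s 0 = s 0"
| "lshift q a b s (Suc 0) = lam q a b s 0"
| "lshift q a b s (Suc (Suc j)) = lam q a b s (Suc j) - lam q a b s j"

fun mbold :: "nat \<Rightarrow> real \<Rightarrow> real \<Rightarrow> (nat \<Rightarrow> complex mat) \<Rightarrow> nat \<Rightarrow> complex mat" where
  "mbold q a b s 0 = mu q a b s 0"
| "mbold q a b s (Suc j) = mu q a b s (Suc j) - mu q a b s j"

definition U_odd :: "nat \<Rightarrow> nat \<Rightarrow> real \<Rightarrow> real \<Rightarrow> (nat \<Rightarrow> complex mat) \<Rightarrow> complex \<Rightarrow> complex mat" where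
  "U_odd q n a b s z = blk2
     (adj_at (Q2 q a b s n) z * minv (mat_adjoint (Q2 q a b s n (of_real a))))
     (- (adj_at (Q1 q s (n + 1)) z * minv (mat_adjoint (P1 q s (n + 1) (of_real a)))))
     (- ((z - of_real a) * (of_real b - z)) \<cdot>\<^sub>m
         (adj_at (P2 q a b s n) z * minv (mat_adjoint (Q2 q a b s n (of_real a)))))
     (adj_at (P1 q s (n + 1)) z * minv (mat_adjoint (P1 q s (n + 1) (of_real a))))"

end

theory Submission
  imports Defs
begin

text \<open>A \<open>q \<times> q\<close> matrix polynomial is a left-linear functional on sequences: its value at \<open>z\<close> is
  the functional at the powers of \<open>z\<close>, its polynomial of the second kind the functional at the
  sequence \<open>h\<^sub>l = \<Sum>m<l. z\<^sup>l\<^sup>-\<^sup>1\<^sup>-\<^sup>m s\<^sub>m\<close>. Multiplication of the weight by \<open>t - c\<close> is the difference operator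
  \<open>(D\<^sub>c x)\<^sub>i = x\<^sub>i\<^sub>+\<^sub>1 - c x\<^sub>i\<close>, so that \<open>\<rho> = - D\<^sub>b s\<close> and \<open>D\<^sub>a \<rho>\<close> are the moments of \<open>K\<^sub>1\<close> and \<open>H\<^sub>2\<close>. The
  polynomial \<open>P\<^sub>2\<^sub>,\<^sub>k\<close> normalised by \<open>Q\<^sub>2\<^sub>,\<^sub>k(a)\<close> is the reproducing kernel \<open>F\<^sub>k\<close> of \<open>\<rho>\<close> at \<open>a\<close>, and
  \<open>\<Gamma>\<^sub>1\<^sub>,\<^sub>k\<close> normalised at \<open>a\<close> is \<open>G\<^sub>k\<close> with \<open>G\<^sub>k x = x\<^sub>0 - E\<^sub>k (D\<^sub>a x)\<close>, where \<open>E\<^sub>k\<close> represents \<open>\<rho>\<close> in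
  terms of \<open>D\<^sub>a \<rho>\<close>. Orthogonality determines both up to a left factor; hence
  \<open>E\<^sub>k\<^sub>+\<^sub>1 = E\<^sub>k + l\<^sub>k F\<^sub>k\<close> and \<open>F\<^sub>k\<^sub>+\<^sub>1 = F\<^sub>k + m\<^sub>k\<^sub>+\<^sub>1 G\<^sub>k\<^sub>+\<^sub>1\<close>, which are the elementary factors of the product,
  and \<open>P\<^sub>1\<^sub>,\<^sub>n\<^sub>+\<^sub>1\<close> normalised at \<open>a\<close> equals \<open>G\<^sub>n - X F\<^sub>n D\<^sub>a\<close> with \<open>X\<close> Hermitian, which is the last one.\<close>

subsection \<open>Star rings and linear functionals on sequences\<close>

text \<open>The kernel recursion needs only sums, products and adjoints of q x q blocks, so it is
  carried out in a noncommutative ring with involution.\<close>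

class star_ring = ring_1 +
  fixes star :: "'a \<Rightarrow> 'a"
  assumes star_add: "star (x + y) = star x + star y"
    and star_mult: "star (x * y) = star y * star x"
    and star_star [simp]: "star (star x) = x"
begin

lemma star_zero [simp]: "star 0 = 0"
  using star_add[of 0 0] by simp

lemma star_one [simp]: "star 1 = 1"
  using star_mult[of "star 1" 1] by simp

lemma star_minus: "star (- x) = - star x"
  using star_add[of x "- x"] by (simp add: eq_neg_iff_add_eq_0 add.commute)

lemma star_diff: "star (x - y) = star x - star y"
  using star_add[of x "- y"] by (simp add: star_minus)

lemma star_sum: "star (sum f A) = (\<Sum>i\<in>A. star (f i))"
  by (induction A rule: infinite_finite_induct) (auto simp: star_add)

lemma star_power: "star (x ^ k) = star x ^ k"
  by (induction k) (simp_all add: star_mult power_commutes)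

end

text \<open>Models scalars such as \<open>a\<close>, \<open>b\<close>, \<open>z\<close>, which may
  be pulled past matrix coefficients.\<close>

definition central :: "'a::ring_1 \<Rightarrow> bool" where
  "central c \<longleftrightarrow> (\<forall>x. c * x = x * c)"

lemma centralD: "central c \<Longrightarrow> x * c = c * x"
  by (simp add: central_def)

lemma central_left_commute: "central c \<Longrightarrow> x * (c * y) = c * (x * y)"
  by (metis central_def mult.assoc)

lemma central_mult: "central c \<Longrightarrow> central d \<Longrightarrow> central (c * d)"
  unfolding central_def by (metis mult.assoc)

lemma central_power: "central c \<Longrightarrow> central (c ^ k)"
proof (induction k)
  case 0 show ?case by (simp add: central_def)
qed (simp add: central_mult)

lemma central_diff: "central c \<Longrightarrow> central d \<Longrightarrow> central (c - d)"
  by (simp add: central_def left_diff_distrib right_diff_distrib)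

lemma central_star: "central (c::'a::star_ring) \<Longrightarrow> central (star c)"
  unfolding central_def by (metis star_mult star_star)

text \<open>A left polynomial of degree below \<open>k\<close>. Coefficients stand on the left of
  the sequence, hence the centrality hypothesis when the argument is scaled.\<close>

definition lin :: "nat \<Rightarrow> ((nat \<Rightarrow> 'a::ring_1) \<Rightarrow> 'a) \<Rightarrow> bool" where
  "lin k \<phi> \<longleftrightarrow> (\<exists>c. \<forall>x. \<phi> x = (\<Sum>i<k. c i * x i))"

lemma linI: "(\<And>x. \<phi> x = (\<Sum>i<k. c i * x i)) \<Longrightarrow> lin k \<phi>"
  unfolding lin_def by blast

lemma lin_diff_arg: "lin k \<phi> \<Longrightarrow> \<phi> (\<lambda>i. x i - y i) = \<phi> x - \<phi> y"
  by (auto simp: lin_def right_diff_distrib sum_subtractf)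

lemma lin_add_arg: "lin k \<phi> \<Longrightarrow> \<phi> (\<lambda>i. x i + y i) = \<phi> x + \<phi> y"
  by (auto simp: lin_def distrib_left sum.distrib)

lemma lin_minus_arg: "lin k \<phi> \<Longrightarrow> \<phi> (\<lambda>i. - x i) = - \<phi> x"
  by (auto simp: lin_def sum_negf)

lemma lin_scale_arg: "lin k \<phi> \<Longrightarrow> central e \<Longrightarrow> \<phi> (\<lambda>i. e * x i) = e * \<phi> x"
  by (auto simp: lin_def sum_distrib_left central_left_commute)

lemma lin_mono: "lin k \<phi> \<Longrightarrow> k \<le> k' \<Longrightarrow> lin k' \<phi>"
proof -
  assume "lin k \<phi>" and kk: "k \<le> k'"
  then obtain c where c: "\<And>x. \<phi> x = (\<Sum>i<k. c i * x i)" by (auto simp: lin_def)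
  have "\<phi> x = (\<Sum>i<k'. (if i < k then c i else 0) * x i)" for x
    unfolding c by (rule sum.mono_neutral_cong_left) (use kk in auto)
  then show ?thesis by (rule linI)
qed

lemma lin_diff: "lin k \<phi> \<Longrightarrow> lin k \<psi> \<Longrightarrow> lin k (\<lambda>x. \<phi> x - \<psi> x)"
proof -
  assume "lin k \<phi>" and "lin k \<psi>"
  then obtain c d where "\<And>x. \<phi> x = (\<Sum>i<k. c i * x i)" "\<And>x. \<psi> x = (\<Sum>i<k. d i * x i)"
    by (auto simp: lin_def)
  then have "\<phi> x - \<psi> x = (\<Sum>i<k. (c i - d i) * x i)" for x
    by (simp add: left_diff_distrib sum_subtractf)
  then show ?thesis by (rule linI)
qed

lemma lin_mult: "lin k \<phi> \<Longrightarrow> lin k (\<lambda>x. r * \<phi> x)"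
proof -
  assume "lin k \<phi>"
  then obtain c where "\<And>x. \<phi> x = (\<Sum>i<k. c i * x i)" by (auto simp: lin_def)
  then have "r * \<phi> x = (\<Sum>i<k. (r * c i) * x i)" for x
    by (simp add: sum_distrib_left mult.assoc)
  then show ?thesis by (rule linI)
qed

lemma lin_eval: "i < k \<Longrightarrow> lin k (\<lambda>x. x i)"
  by (rule linI[where c = "\<lambda>j. if j = i then 1 else 0"]) (simp add: if_distrib if_distribR sum.delta cong: if_cong)

definition D :: "'a::ring_1 \<Rightarrow> (nat \<Rightarrow> 'a) \<Rightarrow> nat \<Rightarrow> 'a" where
  "D c x i = x (Suc i) - c * x i"

lemma D_power [simp]: "D c (\<lambda>i. c ^ i) = (\<lambda>i. 0)"
  by (simp add: D_def fun_eq_iff)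

lemma lin_D: "lin k \<phi> \<Longrightarrow> central a \<Longrightarrow> lin (Suc k) (\<lambda>x. \<phi> (D a x))"
proof -
  assume "lin k \<phi>" and a: "central a"
  then obtain c where c: "\<And>x. \<phi> x = (\<Sum>i<k. c i * x i)" by (auto simp: lin_def)
  have "\<phi> (D a x) = (\<Sum>i<Suc k. ((if i = 0 then 0 else c (i - 1))
      - (if i < k then a * c i else 0)) * x i)" for x
  proof -
    have "\<phi> (D a x) = (\<Sum>i<k. c i * x (Suc i)) - (\<Sum>i<k. a * c i * x i)"
      unfolding c by (simp add: D_def right_diff_distrib sum_subtractf central_left_commute[OF a] mult.assoc)
    also have "(\<Sum>i<k. c i * x (Suc i)) = (\<Sum>i<Suc k. (if i = 0 then 0 else c (i - 1)) * x i)"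
      by (subst sum.lessThan_Suc_shift) simp
    also have "(\<Sum>i<k. a * c i * x i) = (\<Sum>i<Suc k. (if i < k then a * c i else 0) * x i)"
      by simp
    finally show ?thesis by (simp only: left_diff_distrib sum_subtractf)
  qed
  then show ?thesis by (rule linI)
qed

text \<open>Division of a left polynomial that vanishes at \<open>a\<close> by \<open>t - a\<close>.\<close>

lemma lin_factor:
  assumes "lin (Suc k) \<phi>" and "\<phi> (\<lambda>i. a ^ i) = 0" and a: "central a"
  shows "\<exists>\<psi>. lin k \<psi> \<and> (\<forall>x. \<phi> x = \<psi> (D a x))"
  using assms(1,2)
proof (induction k arbitrary: \<phi>)
  case 0
  then obtain c where c: "\<And>x. \<phi> x = c (0::nat) * x 0" by (auto simp: lin_def)
  with 0(2) have "c 0 = 0" by simp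
  then have "lin 0 (\<lambda>x. 0) \<and> (\<forall>x. \<phi> x = 0)" using c by (simp add: lin_def)
  then show ?case by (intro exI[of _ "\<lambda>x. 0"]) simp
next
  case (Suc k)
  from Suc.prems(1) obtain c where c: "\<And>x. \<phi> x = (\<Sum>i<Suc (Suc k). c i * x i)"
    by (auto simp: lin_def)
  \<comment> \<open>Subtracting the leading coefficient times \<open>D a x k\<close> removes the top
    term and keeps the zero at \<open>a\<close>, so the induction hypothesis applies one degree
    lower.\<close>
  define \<phi>' where "\<phi>' x = \<phi> x - c (Suc k) * D a x k" for x
  have "\<phi>' x = (\<Sum>i<Suc k. (c i + (if i = k then c (Suc k) * a else 0)) * x i)" for x
    by (simp add: \<phi>'_def c D_def algebra_simps)
  then have "lin (Suc k) \<phi>'" by (rule linI)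
  moreover have "\<phi>' (\<lambda>i. a ^ i) = 0" by (simp add: \<phi>'_def Suc.prems(2))
  ultimately obtain \<psi> where \<psi>: "lin k \<psi>" "\<And>x. \<phi>' x = \<psi> (D a x)"
    using Suc.IH by blast
  from \<psi>(1) obtain d where d: "\<And>x. \<psi> x = (\<Sum>i<k. d i * x i)" by (auto simp: lin_def)
  define \<psi>' where "\<psi>' x = \<psi> x + c (Suc k) * x k" for x
  have "\<psi>' x = (\<Sum>i<Suc k. (d(k := c (Suc k))) i * x i)" for x
    by (simp add: \<psi>'_def d)
  then have "lin (Suc k) \<psi>'" by (rule linI)
  moreover have "\<phi> x = \<psi>' (D a x)" for x
    using \<psi>(2)[of x] by (simp add: \<phi>'_def \<psi>'_def algebra_simps)
  ultimately show ?case by blast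
qed

section \<open>Hankel inverses, reproducing functionals and orthogonal polynomials\<close>

definition hinv :: "(nat \<Rightarrow> 'a::ring_1) \<Rightarrow> nat \<Rightarrow> (nat \<Rightarrow> nat \<Rightarrow> 'a) \<Rightarrow> bool" where
  "hinv \<kappa> k J \<longleftrightarrow> (\<forall>l<k. \<forall>i<k. (\<Sum>r<k. \<kappa> (l + r) * J r i) = (if l = i then 1 else 0)
     \<and> (\<Sum>r<k. J l r * \<kappa> (r + i)) = (if l = i then 1 else 0))"

text \<open>The functional with coefficient row \<open>g\<close> times the inverse Hankel matrix; it
  interpolates the values \<open>g l\<close> at the shifted moments
  (\<open>ker_repro\<close>).\<close>

definition ker :: "(nat \<Rightarrow> nat \<Rightarrow> 'a::ring_1) \<Rightarrow> nat \<Rightarrow> (nat \<Rightarrow> 'a) \<Rightarrow> (nat \<Rightarrow> 'a) \<Rightarrow> 'a" where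
  "ker J k g x = (\<Sum>i<k. (\<Sum>l<k. g l * J l i) * x i)"

text \<open>The monic left orthogonal polynomial of degree \<open>k\<close>: its coefficient row is
  the block row \<open>(-Y^* H^{-1}, I)\<close> of the definitions.\<close>

definition OP :: "(nat \<Rightarrow> 'a::ring_1) \<Rightarrow> (nat \<Rightarrow> nat \<Rightarrow> 'a) \<Rightarrow> nat \<Rightarrow> (nat \<Rightarrow> 'a) \<Rightarrow> 'a" where
  "OP \<kappa> J k x = x k - ker J k (\<lambda>l. \<kappa> (k + l)) x"

lemma lin_ker: "lin k (ker J k g)"
  by (rule linI) (simp add: ker_def)

lemma ker_zero [simp]: "ker J k g (\<lambda>i. 0) = 0"
  by (simp add: ker_def)

lemma ker_repro:
  assumes "hinv \<kappa> k J" "l < k"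
  shows "ker J k g (\<lambda>i. \<kappa> (l + i)) = g l"
proof -
  have "ker J k g (\<lambda>i. \<kappa> (l + i)) = (\<Sum>i<k. \<Sum>m<k. g m * (J m i * \<kappa> (i + l)))"
    by (simp add: ker_def sum_distrib_right mult.assoc add.commute)
  also have "\<dots> = (\<Sum>m<k. g m * (\<Sum>i<k. J m i * \<kappa> (i + l)))"
    by (subst sum.swap) (simp add: sum_distrib_left)
  also have "\<dots> = (\<Sum>m<k. g m * (if m = l then 1 else 0))"
    using assms by (intro sum.cong) (auto simp: hinv_def)
  also have "\<dots> = g l" using assms(2) by (simp add: if_distrib sum.delta cong: if_cong)
  finally show ?thesis .
qed

text \<open>The coefficient row annihilates the Hankel matrix; multiplying by \<open>J\<close> from
  the right recovers each coefficient as zero.\<close>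

lemma lin_eq_zero:
  assumes "lin k \<phi>" "hinv \<kappa> k J" "\<And>l. l < k \<Longrightarrow> \<phi> (\<lambda>i. \<kappa> (l + i)) = 0"
  shows "\<phi> x = 0"
proof -
  from assms(1) obtain d where d: "\<And>x. \<phi> x = (\<Sum>i<k. d i * x i)" by (auto simp: lin_def)
  have "d j = 0" if j: "j < k" for j
  proof -
    have "d j = (\<Sum>i<k. d i * (\<Sum>r<k. \<kappa> (i + r) * J r j))"
    proof -
      have "(\<Sum>i<k. d i * (\<Sum>r<k. \<kappa> (i + r) * J r j)) = (\<Sum>i<k. d i * (if i = j then 1 else 0))"
        using assms(2) j by (intro sum.cong) (auto simp: hinv_def)
      then show ?thesis using j by (simp add: if_distrib sum.delta cong: if_cong)
    qed
    also have "\<dots> = (\<Sum>r<k. (\<Sum>i<k. d i * \<kappa> (i + r)) * J r j)"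
      by (simp add: sum_distrib_left sum_distrib_right mult.assoc) (rule sum.swap)
    also have "\<dots> = 0"
      using assms(3) by (intro sum.neutral) (simp add: d add.commute)
    finally show ?thesis .
  qed
  then show ?thesis by (simp add: d)
qed

lemma lin_OP: "lin (Suc k) (OP \<kappa> J k)"
  unfolding OP_def[abs_def] by (intro lin_diff lin_eval lin_mono[OF lin_ker]) auto

lemma OP_orth:
  assumes "hinv \<kappa> k J" "l < k"
  shows "OP \<kappa> J k (\<lambda>i. \<kappa> (l + i)) = 0"
  using ker_repro[OF assms] by (simp add: OP_def add.commute)

text \<open>The factor is the leading coefficient: removing that multiple of \<open>OP\<close>
  leaves an orthogonal functional of lower degree, which is zero.\<close>

lemma orth_eq_mult_OP:
  assumes "lin (Suc k) \<phi>" "hinv \<kappa> k J" "\<And>l. l < k \<Longrightarrow> \<phi> (\<lambda>i. \<kappa> (l + i)) = 0"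
  shows "\<exists>c. \<forall>x. \<phi> x = c * OP \<kappa> J k x"
proof -
  from assms(1) obtain c where c: "\<And>x. \<phi> x = (\<Sum>i<Suc k. c i * x i)" by (auto simp: lin_def)
  define \<psi> where "\<psi> x = \<phi> x - c k * OP \<kappa> J k x" for x
  have "\<psi> x = (\<Sum>i<k. (c i + c k * (\<Sum>l<k. \<kappa> (k + l) * J l i)) * x i)" for x
  proof -
    have "c k * ker J k (\<lambda>l. \<kappa> (k + l)) x = (\<Sum>i<k. c k * (\<Sum>l<k. \<kappa> (k + l) * J l i) * x i)"
      unfolding ker_def by (subst sum_distrib_left) (simp only: mult.assoc)
    then show ?thesis
      by (simp only: \<psi>_def c OP_def right_diff_distrib distrib_right sum.distrib) simp
  qed
  then have "lin k \<psi>" by (rule linI)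
  moreover have "\<psi> (\<lambda>i. \<kappa> (l + i)) = 0" if "l < k" for l
    using that assms(3) OP_orth[OF assms(2)] by (simp add: \<psi>_def)
  ultimately have "\<psi> x = 0" for x using lin_eq_zero assms(2) by blast
  then show ?thesis by (auto simp: \<psi>_def)
qed

text \<open>Writing \<open>g\<close> through the values of \<open>\<phi>\<close> turns
  \<open>\<phi> g\<close> into a quadratic form in the coefficients with a self-adjoint Hankel
  kernel.\<close>

lemma lin_self_adjoint:
  fixes \<kappa> :: "nat \<Rightarrow> 'a::star_ring"
  assumes "lin k \<phi>" "\<And>j. star (\<kappa> j) = \<kappa> j" "\<And>j. star (g j) = g j"
    and "\<And>l. l < k \<Longrightarrow> \<phi> (\<lambda>i. \<kappa> (l + i)) = g l"
  shows "star (\<phi> g) = \<phi> g"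
proof -
  from assms(1) obtain d where d: "\<And>x. \<phi> x = (\<Sum>i<k. d i * x i)" by (auto simp: lin_def)
  have "\<phi> g = (\<Sum>i<k. d i * star (g i))" by (simp add: d assms(3))
  also have "\<dots> = (\<Sum>i<k. d i * star (\<phi> (\<lambda>j. \<kappa> (i + j))))"
    using assms(4) by simp
  also have "\<dots> = (\<Sum>i<k. \<Sum>j<k. d i * \<kappa> (i + j) * star (d j))"
    by (simp add: d star_sum star_mult sum_distrib_left assms(2) mult.assoc)
  finally have *: "\<phi> g = (\<Sum>i<k. \<Sum>j<k. d i * \<kappa> (i + j) * star (d j))" .
  have "star (\<phi> g) = (\<Sum>i<k. \<Sum>j<k. d j * \<kappa> (j + i) * star (d i))"
    unfolding * by (simp add: star_sum star_mult assms(2) mult.assoc add.commute)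
  also have "\<dots> = \<phi> g" unfolding * by (rule sum.swap)
  finally show ?thesis .
qed

text \<open>Coefficients \<open>\<Sum>m<l. c\<^sup>l\<^sup>-\<^sup>1\<^sup>-\<^sup>m s\<^sub>m\<close> of polynomials of the second kind.\<close>

primrec hseq :: "(nat \<Rightarrow> 'a::ring_1) \<Rightarrow> 'a \<Rightarrow> nat \<Rightarrow> 'a" where
  "hseq s c 0 = 0"
| "hseq s c (Suc l) = c * hseq s c l + s l"

lemma D_hseq: "D c (hseq s c) = s"
  by (simp add: D_def fun_eq_iff)

lemma hseq_shift:
  "hseq (\<lambda>m. s (m + Suc i)) c l = hseq (\<lambda>m. s (m + i)) c (Suc l) - c ^ l * s i"
proof (induction l)
  case (Suc l)
  have "hseq (\<lambda>m. s (m + Suc i)) c (Suc l) = c * hseq (\<lambda>m. s (m + Suc i)) c l + s (Suc l + i)"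
    by simp
  then show ?case unfolding Suc.IH by (simp add: right_diff_distrib mult.assoc add_diff_eq)
qed simp

text \<open>A confluent Christoffel--Darboux identity: it makes the last parameter Hermitian.\<close>

lemma hseq_swap:
  assumes c: "central c"
  shows "hseq (\<lambda>m. s (m + i)) c l - hseq (\<lambda>m. s (m + l)) c i
       = c ^ i * hseq s c l - c ^ l * hseq s c i"
proof (induction i arbitrary: l)
  case (Suc i)
  have "hseq (\<lambda>m. s (m + Suc i)) c l - hseq (\<lambda>m. s (m + l)) c (Suc i)
      = c * (hseq (\<lambda>m. s (m + i)) c l - hseq (\<lambda>m. s (m + l)) c i) - c ^ l * s i"
    unfolding hseq_shift by (simp add: algebra_simps)
  also have "\<dots> = c ^ Suc i * hseq s c l - c ^ l * hseq s c (Suc i)"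
    unfolding Suc.IH
    by (simp add: right_diff_distrib distrib_left mult.assoc central_left_commute[OF central_power[OF c]] power_commutes)
  finally show ?case .
qed simp

text \<open>The double sum of \<open>d l * hseq (\<lambda>m. s (m + l)) c i * star (d i)\<close> is
  evaluated twice: summation over \<open>l\<close> gives zero by orthogonality, summation over
  \<open>i\<close> gives the difference of \<open>star (N (hseq s c))\<close> and
  \<open>N (hseq s c)\<close>.\<close>

lemma lin_hseq_self_adjoint:
  fixes s :: "nat \<Rightarrow> 'a::star_ring"
  assumes N: "lin (Suc k) N" and s: "\<And>j. star (s j) = s j"
    and c: "central c" "star c = c" and N1: "N (\<lambda>i. c ^ i) = 1"
    and orth: "\<And>l. l < k \<Longrightarrow> N (\<lambda>i. s (l + i)) = 0"
  shows "star (N (hseq s c)) = N (hseq s c)"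
proof -
  from N obtain d where d: "\<And>x. N x = (\<Sum>i<Suc k. d i * x i)" by (auto simp: lin_def)
  \<comment> \<open>The sequence combines shifted moments \<open>s (m + i)\<close> with
    \<open>m < l \<le> k\<close>, all of which \<open>N\<close> annihilates.\<close>
  have z1: "N (\<lambda>i. hseq (\<lambda>m. s (m + i)) c l) = 0" if "l \<le> k" for l
    using that
  proof (induction l)
    case 0 then show ?case by (simp add: d)
  next
    case (Suc l)
    have "N (\<lambda>i. hseq (\<lambda>m. s (m + i)) c (Suc l))
        = c * N (\<lambda>i. hseq (\<lambda>m. s (m + i)) c l) + N (\<lambda>i. s (l + i))"
      by (simp add: lin_add_arg[OF N] lin_scale_arg[OF N c(1)])
    then show ?case using Suc orth by simp
  qed
  have hst: "star (hseq (\<lambda>m. s (m + i)) c l) = hseq (\<lambda>m. s (m + i)) c l" for i l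
    by (induction l) (simp_all add: star_add star_mult s c(2) centralD[OF c(1)])
  have hst0: "star (hseq s c l) = hseq s c l" for l using hst[of 0] by simp
  \<comment> \<open>\<open>hseq_swap\<close> exchanges shift and index; \<open>z1\<close> kills one
    term and the normalisation \<open>N1\<close> evaluates another.\<close>
  have e1: "N (\<lambda>i. hseq (\<lambda>m. s (m + l)) c i) = c ^ l * N (hseq s c) - hseq s c l"
    if "l \<le> k" for l
  proof -
    have "N (\<lambda>i. hseq (\<lambda>m. s (m + i)) c l) - N (\<lambda>i. hseq (\<lambda>m. s (m + l)) c i)
        = N (\<lambda>i. c ^ i * hseq s c l) - N (\<lambda>i. c ^ l * hseq s c i)"
      unfolding lin_diff_arg[OF N, symmetric] hseq_swap[OF c(1)] ..
    moreover have "N (\<lambda>i. c ^ i * hseq s c l) = N (\<lambda>i. c ^ i) * hseq s c l"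
      unfolding d sum_distrib_right by (simp add: mult.assoc)
    ultimately show ?thesis
      using z1[OF that] N1
      by (simp add: lin_scale_arg[OF N central_power[OF c(1)]] eq_diff_eq diff_eq_eq minus_equation_iff[of _ "_ - _"] algebra_simps)
  qed
  have "0 = star (\<Sum>l<Suc k. d l * star (N (\<lambda>i. hseq (\<lambda>m. s (m + l)) c i)))"
  proof -
    have "(\<Sum>l<Suc k. d l * star (N (\<lambda>i. hseq (\<lambda>m. s (m + l)) c i)))
        = (\<Sum>l<Suc k. \<Sum>i<Suc k. d l * (hseq (\<lambda>m. s (m + l)) c i * star (d i)))"
      unfolding d by (simp only: star_sum star_mult hst sum_distrib_left)
    also have "\<dots> = (\<Sum>i<Suc k. N (\<lambda>l. hseq (\<lambda>m. s (m + l)) c i) * star (d i))"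
      unfolding d by (subst sum.swap) (simp only: sum_distrib_right mult.assoc)
    also have "\<dots> = 0" by (intro sum.neutral) (auto simp: z1)
    finally show ?thesis by simp
  qed
  also have "(\<Sum>l<Suc k. d l * star (N (\<lambda>i. hseq (\<lambda>m. s (m + l)) c i)))
      = (\<Sum>l<Suc k. d l * (c ^ l * star (N (hseq s c)) - hseq s c l))"
    by (intro sum.cong refl)
      (simp add: e1 star_diff star_mult star_power c(2) hst0 centralD[OF central_power[OF c(1)]])
  also have "\<dots> = N (\<lambda>i. c ^ i) * star (N (hseq s c)) - N (hseq s c)"
    unfolding d sum_distrib_right by (simp only: right_diff_distrib sum_subtractf mult.assoc)
  finally have "star (star (N (hseq s c)) - N (hseq s c)) = 0" by (simp add: N1)
  then have "star (star (star (N (hseq s c)) - N (hseq s c))) = star 0" by (simp only:)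
  then show ?thesis by simp
qed

subsection \<open>Recursion of the reproducing kernels\<close>

text \<open>The two size bounds mirror the data: \<open>K1\<close> yields Hankel inverses up to size
  \<open>n + 1\<close>, \<open>H2\<close> only up to size \<open>n\<close>.\<close>

locale hausdorff_ring =
  fixes a b :: "'a::star_ring" and s :: "nat \<Rightarrow> 'a" and n :: nat
    and J1 J2 :: "nat \<Rightarrow> nat \<Rightarrow> nat \<Rightarrow> 'a"
  assumes a: "central a" "star a = a" and b: "central b" "star b = b"
    and s: "\<And>j. star (s j) = s j"
    and J1: "\<And>k. k \<le> Suc n \<Longrightarrow> hinv (\<lambda>j. b * s j - s (Suc j)) k (J1 k)"
    and J2: "\<And>k. k \<le> n \<Longrightarrow> hinv (D a (\<lambda>j. b * s j - s (Suc j))) k (J2 k)"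
begin

definition rho :: "nat \<Rightarrow> 'a" where "rho j = b * s j - s (Suc j)"

lemma hinv_J1: "k \<le> Suc n \<Longrightarrow> hinv rho k (J1 k)"
  using J1 by (simp add: rho_def[abs_def])

lemma hinv_J2: "k \<le> n \<Longrightarrow> hinv (D a rho) k (J2 k)"
  using J2 by (simp add: rho_def[abs_def])

lemma star_rho: "star (rho j) = rho j"
  by (simp add: rho_def star_diff star_mult s b centralD[OF b(1)])

lemma star_D_rho: "star (D a rho j) = D a rho j"
  by (simp add: D_def star_diff star_mult star_rho a centralD[OF a(1)])

lemma D_rho_shift: "(\<lambda>i. D a rho (l + i)) = D a (\<lambda>i. rho (l + i))"
  by (simp add: D_def fun_eq_iff)

lemma D_hseq_b: "D b (hseq s c) = (\<lambda>i. s i - (b - c) * hseq s c i)"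
  by (simp add: D_def fun_eq_iff algebra_simps)

text \<open>Difference operators with central constants commute and
  \<open>D c (hseq s c) = s\<close>, so \<open>D c (D b (hseq s c)) = D b s = - rho\<close>; passing
  from \<open>D c\<close> to \<open>D a\<close> adds the first term.\<close>

lemma D_D_hseq:
  assumes c: "central c"
  shows "D a (D b (hseq s c)) = (\<lambda>i. (c - a) * D b (hseq s c) i - rho i)"
proof
  fix i
  have "b * (c * hseq s c i) = c * (b * hseq s c i)"
    by (rule central_left_commute[OF c])
  then show "D a (D b (hseq s c)) i = (c - a) * D b (hseq s c) i - rho i"
    by (simp add: D_def rho_def left_diff_distrib right_diff_distrib distrib_left)
qed

text \<open>Up to an invertible left factor, \<open>F k\<close> is \<open>P\<^sub>2\<^sub>,\<^sub>k\<close> and \<open>G k\<close> is \<open>\<Gamma>\<^sub>1\<^sub>,\<^sub>k\<close>.\<close>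

definition F :: "nat \<Rightarrow> (nat \<Rightarrow> 'a) \<Rightarrow> 'a" where "F k = ker (J1 (Suc k)) (Suc k) (\<lambda>i. a ^ i)"
definition E :: "nat \<Rightarrow> (nat \<Rightarrow> 'a) \<Rightarrow> 'a" where "E k = ker (J2 k) k rho"
definition G :: "nat \<Rightarrow> (nat \<Rightarrow> 'a) \<Rightarrow> 'a" where "G k x = x 0 - E k (D a x)"

lemma lin_F: "lin (Suc k) (F k)" unfolding F_def by (rule lin_ker)
lemma lin_E: "lin k (E k)" unfolding E_def by (rule lin_ker)
lemma lin_G: "lin (Suc k) (G k)"
  unfolding G_def[abs_def] by (intro lin_diff lin_eval lin_D lin_E a) simp

lemma F_rho: "k \<le> n \<Longrightarrow> l \<le> k \<Longrightarrow> F k (\<lambda>i. rho (l + i)) = a ^ l"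
  unfolding F_def by (rule ker_repro[OF hinv_J1]) auto

lemma F_rho0: "k \<le> n \<Longrightarrow> F k rho = 1"
  using F_rho[of k 0] by simp

lemma lin_apply_D: "lin k \<phi> \<Longrightarrow> \<phi> (D a x) = \<phi> (\<lambda>i. x (Suc i)) - a * \<phi> x"
  unfolding D_def[abs_def] by (simp add: lin_diff_arg[of k \<phi>] lin_scale_arg[of k \<phi>] a)

text \<open>The values of \<open>F k\<close> at the shifts of \<open>rho\<close> are powers of
  \<open>a\<close>, so the two terms of \<open>D a\<close> cancel. Thus the kernel of
  \<open>rho\<close> at \<open>a\<close> is orthogonal for \<open>D a rho\<close>.\<close>

lemma F_orth: "k \<le> n \<Longrightarrow> l < k \<Longrightarrow> F k (\<lambda>i. D a rho (l + i)) = 0"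
  unfolding D_rho_shift lin_apply_D[OF lin_F]
  using F_rho[of k l] F_rho[of k "Suc l"] by simp

lemma E_repro: "k \<le> n \<Longrightarrow> l < k \<Longrightarrow> E k (\<lambda>i. D a rho (l + i)) = rho l"
  unfolding E_def by (rule ker_repro[OF hinv_J2])

lemma G_orth: "k \<le> n \<Longrightarrow> l < k \<Longrightarrow> G k (\<lambda>i. rho (l + i)) = 0"
  using E_repro[of k l] by (simp add: G_def D_rho_shift)

lemma G_power: "G k (\<lambda>i. a ^ i) = 1"
  using lin_scale_arg[OF lin_E a(1), of k "\<lambda>i. 0"] by (simp add: G_def E_def)

text \<open>Orthogonality to \<open>D a rho\<close> makes the values at the shifts of
  \<open>rho\<close> a geometric progression with ratio \<open>a\<close>. So are those of
  \<open>F k\<close>, and \<open>k + 1\<close> such values determine the functional.\<close>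

lemma F_unique:
  assumes \<phi>: "lin (Suc k) \<phi>" and k: "k \<le> n"
    and orth: "\<And>l. l < k \<Longrightarrow> \<phi> (\<lambda>i. D a rho (l + i)) = 0"
  shows "\<phi> x = \<phi> rho * F k x"
proof -
  have *: "\<phi> (\<lambda>i. rho (l + i)) = a ^ l * \<phi> rho" if "l \<le> k" for l
    using that
  proof (induction l)
    case (Suc l)
    then have "\<phi> (\<lambda>i. rho (Suc l + i)) = a * \<phi> (\<lambda>i. rho (l + i))"
      using orth[of l] unfolding D_rho_shift lin_apply_D[OF \<phi>] by simp
    then show ?case using Suc by (simp add: mult.assoc)
  qed simp
  have "\<phi> x - \<phi> rho * F k x = 0"
  proof (rule lin_eq_zero[OF lin_diff[OF \<phi> lin_mult[OF lin_F]] hinv_J1])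
    fix l assume "l < Suc k"
    then show "\<phi> (\<lambda>i. rho (l + i)) - \<phi> rho * F k (\<lambda>i. rho (l + i)) = 0"
      using * F_rho[OF k] centralD[OF central_power[OF a(1)]] by simp
  qed (use k in auto)
  then show ?thesis by simp
qed

text \<open>Once a multiple of \<open>x 0\<close> is subtracted, the functional is divisible by
  \<open>t - a\<close>; orthogonality forces the quotient to be a multiple of
  \<open>E k\<close>.\<close>

lemma G_unique:
  assumes \<phi>: "lin (Suc k) \<phi>" and k: "k \<le> n"
    and orth: "\<And>l. l < k \<Longrightarrow> \<phi> (\<lambda>i. rho (l + i)) = 0"
  shows "\<phi> x = \<phi> (\<lambda>i. a ^ i) * G k x"
proof -
  define c where "c = \<phi> (\<lambda>i. a ^ i)"
  have "lin (Suc k) (\<lambda>x. \<phi> x - c * x 0)"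
    by (intro lin_diff lin_mult lin_eval \<phi>) simp
  moreover have "\<phi> (\<lambda>i. a ^ i) - c * a ^ 0 = 0" by (simp add: c_def)
  ultimately obtain \<psi> where \<psi>: "lin k \<psi>" "\<And>x. \<phi> x - c * x 0 = \<psi> (D a x)"
    using lin_factor[OF _ _ a(1)] by blast
  have "\<psi> x - (- c) * E k x = 0" for x
  proof (rule lin_eq_zero[OF lin_diff[OF \<psi>(1) lin_mult[OF lin_E]] hinv_J2[OF k]])
    fix l assume l: "l < k"
    have "\<psi> (\<lambda>i. D a rho (l + i)) = - c * rho l"
      unfolding D_rho_shift \<psi>(2)[symmetric] using orth[OF l] by simp
    then show "\<psi> (\<lambda>i. D a rho (l + i)) - - c * E k (\<lambda>i. D a rho (l + i)) = 0"
      using E_repro[OF k l] by simp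
  qed
  then have "\<phi> x = c * x 0 - c * E k (D a x)"
    using \<psi>(2)[of x] by (simp add: eq_neg_iff_add_eq_0[symmetric] diff_eq_eq)
  then show ?thesis by (simp add: G_def c_def right_diff_distrib)
qed

section \<open>Parameters as increments, and the one-step recursions\<close>

definition mm :: "nat \<Rightarrow> 'a" where
  "mm k = (if k = 0 then F 0 (\<lambda>i. a ^ i) else F k (\<lambda>i. a ^ i) - F (k - 1) (\<lambda>i. a ^ i))"

text \<open>The index is shifted as in \<open>lshift\<close>: for positive \<open>k\<close>,
  \<open>E k rho\<close> is lambda with index \<open>k - 1\<close>, while \<open>E 0 rho\<close> is
  zero.\<close>

definition ll :: "nat \<Rightarrow> 'a" where
  "ll k = (if k = 0 then s 0 else E k rho - E (k - 1) rho)"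

text \<open>Both functionals reproduce \<open>rho\<close> on the first \<open>k\<close> shifts of
  \<open>D a rho\<close>, so \<open>F_unique\<close> applies to their difference.\<close>

lemma E_Suc: "Suc k \<le> n \<Longrightarrow> E (Suc k) x = E k x + ll (Suc k) * F k x"
  using F_unique[of k "\<lambda>x. E (Suc k) x - E k x" x]
    lin_diff[OF lin_E[of "Suc k"] lin_mono[OF lin_E[of k]]]
  by (simp add: E_repro ll_def algebra_simps)

text \<open>Both kernels take the value \<open>a ^ l\<close> at the shifts \<open>l \<le> k\<close>
  of \<open>rho\<close>, so \<open>G_unique\<close> applies to their difference and the factor is
  read off at the powers of \<open>a\<close>.\<close>

lemma F_Suc: "Suc k \<le> n \<Longrightarrow> F (Suc k) x = F k x + mm (Suc k) * G (Suc k) x"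
  using G_unique[of "Suc k" "\<lambda>x. F (Suc k) x - F k x" x]
    lin_diff[OF lin_F[of "Suc k"] lin_mono[OF lin_F[of k]]]
  by (simp add: F_rho mm_def algebra_simps)

lemma F_0: "F 0 x = mm 0 * x 0"
  by (simp add: mm_def F_def ker_def)

lemma G_0: "G 0 x = x 0"
  by (simp add: G_def E_def ker_def)

lemma G_Suc: "Suc k \<le> n \<Longrightarrow> G (Suc k) x = G k x - ll (Suc k) * F k (D a x)"
  by (simp add: G_def E_Suc)

lemma star_E_rho: "k \<le> n \<Longrightarrow> star (E k rho) = E k rho"
  by (rule lin_self_adjoint[OF lin_E star_D_rho star_rho E_repro])

lemma star_F_power: "k \<le> n \<Longrightarrow> star (F k (\<lambda>i. a ^ i)) = F k (\<lambda>i. a ^ i)"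
  by (rule lin_self_adjoint[where \<kappa> = rho, OF lin_F star_rho]) (simp_all add: star_power a F_rho)

lemma star_ll: "k \<le> n \<Longrightarrow> star (ll k) = ll k"
  by (simp add: ll_def s star_diff star_E_rho)

lemma star_mm: "k \<le> n \<Longrightarrow> star (mm k) = mm k"
  by (simp add: mm_def s star_diff star_F_power)

text \<open>\<open>w\<close> plays the conjugate of \<open>z\<close>: the resolvent entries are
  adjoints of polynomial values at the conjugate point, and \<open>star\<close> carries
  \<open>w\<close> back to \<open>z\<close>.\<close>

context
  fixes z w :: 'a
  assumes w: "central w" and z: "z = star w"
begin

lemma central_z: "central z"
  unfolding z by (rule central_star[OF w])

lemma D_power_w: "D a (\<lambda>i. w ^ i) = (\<lambda>i. (w - a) * w ^ i)"
  by (simp add: D_def fun_eq_iff left_diff_distrib)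

lemma star_wa: "star (w - a) = z - a"
  by (simp add: star_diff z a)

text \<open>Entries of the partial products of the elementary factors.\<close>

definition M11 where "M11 k = - star (F k (D a (D b (hseq s w))))"
definition M12 where "M12 k = star (G k (D b (hseq s w)))"
definition M21 where "M21 k = - (z - a) * star (F k (\<lambda>i. w ^ i))"
definition M22 where "M22 k = star (G k (\<lambda>i. w ^ i))"

lemma central_wa: "central (w - a)" by (intro central_diff w a)
lemma central_za: "central (z - a)" by (intro central_diff central_z a)

lemma M12_0: "M12 0 = s 0"
  by (simp add: M12_def G_0 D_def s)

lemma M22_0: "M22 0 = 1"
  by (simp add: M22_def G_0)

lemma M21_0: "M21 0 = - (z - a) * mm 0"
  by (simp add: M21_def F_0 star_mm)

text \<open>In degree zero \<open>rho\<close> is not annihilated: \<open>F 0 rho = 1\<close>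
  produces the summand one.\<close>

lemma M11_0: "M11 0 = 1 - (z - a) * s 0 * mm 0"
proof -
  have "F 0 rho = 1" using F_rho0[of 0] by simp
  then have "F 0 (D a (D b (hseq s w))) = (w - a) * (mm 0 * s 0) - 1"
    by (simp add: D_D_hseq[OF w] lin_diff_arg[OF lin_F] lin_scale_arg[OF lin_F central_wa])
       (simp add: F_0 D_def)
  then show ?thesis
    by (simp add: M11_def star_diff[of _ 1] star_mult star_mm s star_wa mult.assoc centralD[OF central_za])
qed

text \<open>Right multiplication by an upper triangular factor changes only the second column; this
  is the adjoint of \<open>G_Suc\<close>. The lower triangular factor changes the first column by
  \<open>F_Suc\<close>.\<close>

lemma M12_Suc: "Suc k \<le> n \<Longrightarrow> M12 (Suc k) = M11 k * ll (Suc k) + M12 k"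
  by (simp add: M12_def M11_def G_Suc star_diff star_mult star_ll)

lemma M22_Suc: "Suc k \<le> n \<Longrightarrow> M22 (Suc k) = M21 k * ll (Suc k) + M22 k"
  by (simp add: M22_def M21_def G_Suc star_diff[of "G _ _"] star_mult star_ll D_power_w
      lin_scale_arg[OF lin_F central_wa] star_wa mult.assoc central_left_commute[OF central_za]
      centralD[OF central_za] del: minus_diff_eq)

lemma M21_Suc: "Suc k \<le> n \<Longrightarrow> M21 (Suc k) = M21 k - (z - a) * M22 (Suc k) * mm (Suc k)"
  by (simp add: M22_def M21_def F_Suc star_add star_mult star_mm mult.assoc distrib_left
      del: minus_diff_eq)

text \<open>\<open>G (Suc k)\<close> annihilates \<open>rho\<close>, so the inhomogeneous term of
  \<open>D_D_hseq\<close> drops out and only the factor \<open>w - a\<close> remains.\<close>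

lemma M11_Suc:
  assumes k: "Suc k \<le> n"
  shows "M11 (Suc k) = M11 k - (z - a) * M12 (Suc k) * mm (Suc k)"
proof -
  have "G (Suc k) rho = 0" using G_orth[of "Suc k" 0] k by simp
  then have "G (Suc k) (D a (D b (hseq s w))) = (w - a) * G (Suc k) (D b (hseq s w))"
    unfolding D_D_hseq[OF w] by (simp add: lin_diff_arg[OF lin_G] lin_scale_arg[OF lin_G central_wa])
  then show ?thesis
    by (simp add: M11_def M12_def F_Suc k star_add star_mult star_mm star_wa mult.assoc
      central_left_commute[OF central_za] centralD[OF central_za])
qed

end

text \<open>The last column: \<open>N\<close> is the normalisation of the orthogonal polynomial of the
  moments \<open>s\<close> at \<open>a\<close>.\<close>

context
  fixes N :: "(nat \<Rightarrow> 'a) \<Rightarrow> 'a"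
  assumes N: "lin (Suc (Suc n)) N" and N1: "N (\<lambda>i. a ^ i) = 1"
    and N_orth: "\<And>l. l \<le> n \<Longrightarrow> N (\<lambda>i. s (l + i)) = 0"
begin

text \<open>The upper right block of the last factor; the normalised functionals \<open>G n\<close>
  and \<open>N\<close> absorb the inverses of \<open>Gamma1\<close> and \<open>P1\<close> at
  \<open>a\<close>.\<close>

definition X where "X = - G n (D b (hseq s a)) - (b - a) * N (hseq s a)"

lemma central_ba: "central (b - a)" by (intro central_diff a b)

lemma N_D_hseq:
  assumes c: "central c"
  shows "N (D b (hseq s c)) = - (b - c) * N (hseq s c)"
  unfolding D_hseq_b lin_diff_arg[OF N] lin_scale_arg[OF N central_diff[OF b(1) c]]
  using N_orth[of 0] by (simp del: minus_diff_eq)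

lemma F_D_D_hseq: "F n (D a (D b (hseq s a))) = - 1"
  unfolding D_D_hseq[OF a(1)] using lin_minus_arg[OF lin_F, of n rho] F_rho0[of n] by simp

text \<open>\<open>N\<close> and \<open>G n\<close> agree at the powers of \<open>a\<close>, so
  their difference is divisible by \<open>t - a\<close>; the quotient is orthogonal to
  \<open>D a rho\<close>, hence a multiple of \<open>F n\<close>.\<close>

lemma N_eq: "N x = G n x - X * F n (D a x)"
proof -
  have "lin (Suc (Suc n)) (\<lambda>x. N x - G n x)"
    by (rule lin_diff[OF N lin_mono[OF lin_G]]) simp
  moreover have "N (\<lambda>i. a ^ i) - G n (\<lambda>i. a ^ i) = 0" by (simp add: N1 G_power)
  ultimately obtain \<psi> where \<psi>: "lin (Suc n) \<psi>" "\<And>x. N x - G n x = \<psi> (D a x)"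
    using lin_factor[OF _ _ a(1), of "Suc n" "\<lambda>x. N x - G n x"] by blast
  \<comment> \<open>Each \<open>rho\<close> involves two consecutive moments, so orthogonality of
    \<open>N\<close> up to index \<open>n\<close> passes to \<open>rho\<close> for
    \<open>l < n\<close>, as many conditions as \<open>F_unique\<close> asks for.\<close>
  have Nrho: "N (\<lambda>i. rho (l + i)) = 0" if "l < n" for l
    unfolding rho_def lin_diff_arg[OF N] lin_scale_arg[OF N b(1)]
    using N_orth[of l] N_orth[of "Suc l"] that by simp
  have "\<psi> (\<lambda>i. D a rho (l + i)) = 0" if "l < n" for l
    unfolding D_rho_shift \<psi>(2)[symmetric] using Nrho[OF that] G_orth[OF _ that] by simp
  then have eq: "\<psi> x = \<psi> rho * F n x" for x by (rule F_unique[OF \<psi>(1) order_refl])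
  have NG: "N x = G n x + \<psi> rho * F n (D a x)" for x
    using \<psi>(2)[of x] eq[of "D a x"] by (simp add: diff_eq_eq add.commute)
  \<comment> \<open>Testing at \<open>D b (hseq s a)\<close>, where \<open>F n (D a x)\<close> is
    \<open>- 1\<close>, identifies the factor.\<close>
  have "\<psi> rho = - X"
    using NG[of "D b (hseq s a)"] by (simp add: F_D_D_hseq N_D_hseq a X_def algebra_simps)
  then show ?thesis using NG[of x] by simp
qed

text \<open>The first summand reduces to \<open>s 0 + E n rho\<close>, the second is covered by
  \<open>lin_hseq_self_adjoint\<close>. Self-adjointness lets \<open>X\<close> itself appear when
  \<open>N_eq\<close> is starred.\<close>

lemma star_X: "star X = X"
proof -
  have 1: "star (N (hseq s a)) = N (hseq s a)"
    by (rule lin_hseq_self_adjoint[OF N s a N1]) (use N_orth in auto)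
  have "G n (D b (hseq s a)) = s 0 + E n rho"
    using lin_minus_arg[OF lin_E, of n rho] by (simp add: G_def D_D_hseq[OF a(1)]) (simp add: D_def)
  then have "star (G n (D b (hseq s a))) = G n (D b (hseq s a))"
    by (simp add: star_add s star_E_rho)
  then show ?thesis
    by (simp add: X_def star_diff star_minus star_mult 1 a b centralD[OF central_ba])
qed

lemma star_N_hseq:
  assumes "central w" "z = star w"
  shows "star (N (D b (hseq s w))) = M11 w n * X + M12 w n"
  using assms by (simp add: N_eq M11_def M12_def star_diff star_mult star_X)

lemma star_N_power:
  assumes w: "central w" "z = star w"
  shows "star (N (\<lambda>i. w ^ i)) = M21 z w n * X + M22 w n"
  using central_za[OF w] by (simp add: N_eq M21_def[OF w] M22_def[OF w] star_diff[of "G _ _"] star_mult star_X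
      D_power_w[OF w] lin_scale_arg[OF lin_F central_wa[OF w]] star_wa[OF w] mult.assoc
      central_left_commute[OF central_za[OF w]] centralD[OF central_za[OF w]]
      del: minus_diff_eq)

end

text \<open>The second conjunct makes \<open>c\<close> a left inverse of the block of
  \<open>Q2\<close> at \<open>a\<close>, from which the invertibility of that matrix is derived.
  \<open>G_eq_mult_OP\<close> does the same for \<open>Gamma1\<close>.\<close>

lemma F_eq_mult_OP:
  assumes k: "k \<le> n"
  shows "\<exists>c. (\<forall>x. F k x = c * OP (D a rho) (J2 k) k x) \<and> c * OP (D a rho) (J2 k) k rho = 1"
  using orth_eq_mult_OP[OF lin_F hinv_J2[OF k] F_orth[OF k]] F_rho0[OF k] by metis

lemma G_eq_mult_OP:
  assumes k: "k \<le> n"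
  shows "\<exists>c. (\<forall>x. G k x = c * OP rho (J1 k) k x) \<and> c * OP rho (J1 k) k (\<lambda>i. a ^ i) = 1"
  using orth_eq_mult_OP[OF lin_G hinv_J1 G_orth[OF k]] k G_power by (metis le_SucI)

end

subsection \<open>Matrix blocks as elements of a star ring\<close>

definition clin :: "((nat \<Rightarrow> complex) \<Rightarrow> nat \<Rightarrow> complex) \<Rightarrow> bool" where
  "clin T \<longleftrightarrow> (\<forall>x y. T (\<lambda>p. x p + y p) = (\<lambda>p. T x p + T y p))
     \<and> (\<forall>c x. T (\<lambda>p. c * x p) = (\<lambda>p. c * T x p))"

lemma clin_add: "clin T \<Longrightarrow> T (\<lambda>p. x p + y p) = (\<lambda>p. T x p + T y p)"
  and clin_scale: "clin T \<Longrightarrow> T (\<lambda>p. c * x p) = (\<lambda>p. c * T x p)"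
  by (simp_all add: clin_def)

lemma clin_zero: "clin T \<Longrightarrow> T (\<lambda>p. 0) = (\<lambda>p. 0)"
  using clin_scale[of T 0] by simp

text \<open>Pairs of operators, the second one playing the role of the adjoint of the first: the
  product ring of the operators and their opposite ring, with the swap as involution.
  Square matrices of every size embed in this one type.\<close>

typedef opair = "{(T, S). clin T \<and> clin S}"
  by (rule exI[of _ "(id, id)"]) (simp add: clin_def)

setup_lifting type_definition_opair

instantiation opair :: star_ring
begin

lift_definition zero_opair :: opair is "(\<lambda>x p. 0, \<lambda>x p. 0)"
  by (simp add: clin_def)

lift_definition one_opair :: opair is "(\<lambda>x. x, \<lambda>x. x)"
  by (simp add: clin_def)

lift_definition plus_opair :: "opair \<Rightarrow> opair \<Rightarrow> opair"
  is "\<lambda>(T, S) (T', S'). (\<lambda>x p. T x p + T' x p, \<lambda>x p. S x p + S' x p)"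
  by (auto simp: clin_def algebra_simps)

lift_definition uminus_opair :: "opair \<Rightarrow> opair"
  is "\<lambda>(T, S). (\<lambda>x p. - T x p, \<lambda>x p. - S x p)"
  by (auto simp: clin_def)

lift_definition minus_opair :: "opair \<Rightarrow> opair \<Rightarrow> opair"
  is "\<lambda>(T, S) (T', S'). (\<lambda>x p. T x p - T' x p, \<lambda>x p. S x p - S' x p)"
  by (auto simp: clin_def algebra_simps)

lift_definition times_opair :: "opair \<Rightarrow> opair \<Rightarrow> opair"
  is "\<lambda>(T, S) (T', S'). (\<lambda>x. T (T' x), \<lambda>x. S' (S x))"
  by (auto simp: clin_def)

lift_definition star_opair :: "opair \<Rightarrow> opair" is "\<lambda>(T, S). (S, T)"
  by auto

instance
proof
  fix x y z :: opair
  show "x + y + z = x + (y + z)" by transfer (auto simp: add.assoc)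
  show "x + y = y + x" by transfer (auto simp: add.commute)
  show "0 + x = x" by transfer auto
  show "- x + x = 0" by transfer auto
  show "x - y = x + - y" by transfer auto
  show "x * y * z = x * (y * z)" by transfer auto
  show "1 * x = x" by transfer auto
  show "x * 1 = x" by transfer auto
  show "(x + y) * z = x * z + y * z" by transfer (auto simp: clin_add)
  show "x * (y + z) = x * y + x * z" by transfer (auto simp: clin_add)
  have "fst (Rep_opair (0::opair)) (\<lambda>p. 1) \<noteq> fst (Rep_opair 1) (\<lambda>p. 1)"
    by transfer (simp add: fun_eq_iff)
  then show "(0::opair) \<noteq> 1" by auto
  show "star (x + y) = star x + star y" by transfer auto
  show "star (x * y) = star y * star x" by transfer auto
  show "star (star x) = x" by transfer auto
qed

end

lift_definition act :: "opair \<Rightarrow> (nat \<Rightarrow> complex) \<Rightarrow> nat \<Rightarrow> complex" is "\<lambda>(T, S). T" .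

lemma act_zero [simp]: "act 0 x = (\<lambda>p. 0)" by transfer simp
lemma act_one [simp]: "act 1 x = x" by transfer simp
lemma act_add: "act (A + B) x = (\<lambda>p. act A x p + act B x p)" by transfer auto
lemma act_mult: "act (A * B) x = act A (act B x)" by transfer auto
lemma act_uminus: "act (- A) x = (\<lambda>p. - act A x p)" by transfer auto
lemma act_diff: "act (A - B) x = (\<lambda>p. act A x p - act B x p)" by transfer auto
lemma act_sum: "act (\<Sum>i\<in>I. f i) x = (\<lambda>p. \<Sum>i\<in>I. act (f i) x p)"
  by (induction I rule: infinite_finite_induct) (auto simp: act_add)
lemma act_null: "act A (\<lambda>p. 0) = (\<lambda>p. 0)" by transfer (auto simp: clin_zero)

lemma opair_eqI:
  assumes "\<And>x. act A x = act B x" "\<And>x. act (star A) x = act (star B) x"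
  shows "A = B"
  using assms by transfer (auto simp: fun_eq_iff)

lift_definition scal :: "complex \<Rightarrow> opair" is "\<lambda>c. (\<lambda>x p. c * x p, \<lambda>x p. cnj c * x p)"
  by (auto simp: clin_def algebra_simps)

lemma act_scal: "act (scal c) x = (\<lambda>p. c * x p)" by transfer simp

lemma central_scal: "central (scal c)"
  unfolding central_def by transfer (auto simp: clin_scale)

lemma star_scal: "star (scal c) = scal (cnj c)" by transfer simp

lemma scal_1 [simp]: "scal 1 = 1" by transfer (simp add: fun_eq_iff)
lemma scal_add: "scal (c + d) = scal c + scal d" by transfer (simp add: algebra_simps fun_eq_iff)
lemma scal_uminus: "scal (- c) = - scal c" by transfer (simp add: fun_eq_iff)
lemma scal_diff: "scal (c - d) = scal c - scal d" by transfer (simp add: algebra_simps fun_eq_iff)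
lemma scal_mult: "scal (c * d) = scal c * scal d" by transfer (simp add: algebra_simps fun_eq_iff)

lemma clin_kernel: "clin (\<lambda>x p. \<Sum>r<(q::nat). f p r * x (g p r))"
  unfolding clin_def
proof (intro conjI allI ext)
  fix x y p c
  show "(\<Sum>r<q. f p r * (x (g p r) + y (g p r))) = (\<Sum>r<q. f p r * x (g p r)) + (\<Sum>r<q. f p r * y (g p r))"
    by (simp only: distrib_left sum.distrib)
  show "(\<Sum>r<q. f p r * (c * x (g p r))) = c * (\<Sum>r<q. f p r * x (g p r))"
    by (simp only: sum_distrib_left mult.left_commute)
qed

text \<open>The \<open>q \<times> q\<close> block in position \<open>(i, j)\<close> of a matrix, acting simultaneously on all
  consecutive segments of length \<open>q\<close>.\<close>

definition blk :: "nat \<Rightarrow> complex mat \<Rightarrow> nat \<Rightarrow> nat \<Rightarrow> opair" where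
  "blk q A i j = Abs_opair
     (\<lambda>x p. \<Sum>r<q. A $$ (i * q + p mod q, j * q + r) * x (p div q * q + r),
      \<lambda>x p. \<Sum>r<q. cnj (A $$ (i * q + r, j * q + p mod q)) * x (p div q * q + r))"

lemma Rep_blk: "Rep_opair (blk q A i j) =
     (\<lambda>x p. \<Sum>r<q. A $$ (i * q + p mod q, j * q + r) * x (p div q * q + r),
      \<lambda>x p. \<Sum>r<q. cnj (A $$ (i * q + r, j * q + p mod q)) * x (p div q * q + r))"
  unfolding blk_def
proof (rule Abs_opair_inverse, unfold mem_Collect_eq prod.case, rule conjI)
  show "clin (\<lambda>x p. \<Sum>r<q. A $$ (i * q + p mod q, j * q + r) * x (p div q * q + r))"
    by (rule clin_kernel[where f = "\<lambda>p r. A $$ (i * q + p mod q, j * q + r)" and g = "\<lambda>p r. p div q * q + r"])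
  show "clin (\<lambda>x p. \<Sum>r<q. cnj (A $$ (i * q + r, j * q + p mod q)) * x (p div q * q + r))"
    by (rule clin_kernel[where f = "\<lambda>p r. cnj (A $$ (i * q + r, j * q + p mod q))" and g = "\<lambda>p r. p div q * q + r"])
qed

lemma act_blk: "act (blk q A i j) x p
    = (\<Sum>r<q. A $$ (i * q + p mod q, j * q + r) * x (p div q * q + r))"
  by (simp add: act.rep_eq Rep_blk)

lemma act_star_blk: "act (star (blk q A i j)) x p
    = (\<Sum>r<q. cnj (A $$ (i * q + r, j * q + p mod q)) * x (p div q * q + r))"
  by (simp add: act.rep_eq star_opair.rep_eq Rep_blk)

lemma block_index: "i < m \<Longrightarrow> r < q \<Longrightarrow> i * q + r < m * (q::nat)"
proof -
  assume "i < m" "r < q"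
  then have "i * q + r < Suc i * q" by simp
  also have "\<dots> \<le> m * q" using \<open>i < m\<close> by (intro mult_le_mono1) simp
  finally show ?thesis .
qed

lemma blk_eqI:
  assumes "q > 0"
    and "\<And>r c. r < q \<Longrightarrow> c < q \<Longrightarrow> A $$ (i * q + r, j * q + c) = B $$ (i' * q + r, j' * q + c)"
  shows "blk q A i j = blk q B i' j'"
  by (rule opair_eqI) (use assms in \<open>auto simp: fun_eq_iff act_blk act_star_blk\<close>)

lemma blk_index:
  assumes "r < q" "c < q"
  shows "act (blk q A i j) (\<lambda>p. if p = c then 1 else 0) r = A $$ (i * q + r, j * q + c)"
  using assms by (simp add: act_blk if_distrib sum.delta cong: if_cong)

text \<open>\<open>blk_index\<close> reads entries off the action on unit sequences, so identities
  in the operator ring descend to matrices.\<close>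

lemma mat_eq_blkI:
  assumes "A \<in> carrier_mat (m * q) (k * q)" "B \<in> carrier_mat (m * q) (k * q)"
    and "\<And>i j. i < m \<Longrightarrow> j < k \<Longrightarrow> blk q A i j = blk q B i j"
  shows "A = B"
proof (rule eq_matI)
  fix r c assume "r < dim_row B" "c < dim_col B"
  with assms(2) have rc: "r < m * q" "c < k * q" by auto
  then have q: "q > 0" by (cases q) auto
  from rc have "r div q < m" "c div q < k" by (auto simp: less_mult_imp_div_less)
  with assms(3)[of "r div q" "c div q"] q
    blk_index[of "r mod q" q "c mod q" A "r div q" "c div q"]
    blk_index[of "r mod q" q "c mod q" B "r div q" "c div q"]
  show "A $$ (r, c) = B $$ (r, c)" by simp
qed (use assms in auto)

lemma blk_add:
  assumes "q > 0" "A \<in> carrier_mat (m * q) (k * q)" "B \<in> carrier_mat (m * q) (k * q)" "i < m" "j < k"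
  shows "blk q (A + B) i j = blk q A i j + blk q B i j"
  by (rule opair_eqI)
     (use assms block_index[of i m _ q] block_index[of j k _ q] in
       \<open>auto simp: fun_eq_iff act_blk act_star_blk act_add star_add sum.distrib distrib_right\<close>)

lemma blk_diff:
  assumes "q > 0" "A \<in> carrier_mat (m * q) (k * q)" "B \<in> carrier_mat (m * q) (k * q)" "i < m" "j < k"
  shows "blk q (A - B) i j = blk q A i j - blk q B i j"
  by (rule opair_eqI)
     (use assms block_index[of i m _ q] block_index[of j k _ q] in
       \<open>auto simp: fun_eq_iff act_blk act_star_blk act_diff star_diff sum_subtractf left_diff_distrib\<close>)

lemma blk_uminus:
  assumes "q > 0" "A \<in> carrier_mat (m * q) (k * q)" "i < m" "j < k"
  shows "blk q (- A) i j = - blk q A i j"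
  by (rule opair_eqI)
     (use assms block_index[of i m _ q] block_index[of j k _ q] in
       \<open>auto simp: fun_eq_iff act_blk act_star_blk act_uminus star_minus sum_negf\<close>)

lemma blk_smult:
  assumes "q > 0" "A \<in> carrier_mat (m * q) (k * q)" "i < m" "j < k"
  shows "blk q (c \<cdot>\<^sub>m A) i j = scal c * blk q A i j"
  by (rule opair_eqI)
     (use assms block_index[of i m _ q] block_index[of j k _ q] in
       \<open>auto simp: fun_eq_iff act_blk act_star_blk act_mult star_mult act_scal star_scal
         sum_distrib_left mult.assoc mult.left_commute\<close>)

text \<open>Acting on every segment makes the identity block the ring unit; acting on the first
  segment alone would give a projection.\<close>

lemma blk_one:
  assumes "q > 0" "i < m" "j < m"
  shows "blk q (1\<^sub>m (m * q)) i j = (if i = j then 1 else 0)"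
proof -
  have neq: "i * q + r \<noteq> j * q + r'" if "i \<noteq> j" "r < q" "r' < q" for r r'
  proof
    assume "i * q + r = j * q + r'"
    then have "(i * q + r) div q = (j * q + r') div q" by simp
    with that show False by simp
  qed
  show ?thesis
    by (rule opair_eqI)
       (use assms neq block_index[of i m _ q] block_index[of j m _ q] in
       \<open>auto simp: fun_eq_iff act_blk act_star_blk if_distrib if_distribR sum.delta sum.delta' cong: if_cong\<close>)
qed

lemma blk_zero:
  assumes "q > 0" "i < m" "j < k"
  shows "blk q (0\<^sub>m (m * q) (k * q)) i j = 0"
  by (rule opair_eqI)
     (use assms block_index[of i m _ q] block_index[of j k _ q] in
       \<open>auto simp: fun_eq_iff act_blk act_star_blk\<close>)

lemma blk_mult:
  assumes q: "q > 0" and A: "A \<in> carrier_mat (m * q) (k * q)" and B: "B \<in> carrier_mat (k * q) (h * q)"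
    and ij: "i < m" "j < h"
  shows "blk q (A * B) i j = (\<Sum>l<k. blk q A i l * blk q B l j)"
proof -
  have shift: "sum g {l * q..<l * q + q} = (\<Sum>t<q. g (l * q + t))" for g :: "nat \<Rightarrow> complex" and l
    using sum.shift_bounds_nat_ivl[of g 0 "l * q" q] by (simp add: atLeast0LessThan add.commute)
  have e: "(A * B) $$ (i * q + r, j * q + c)
      = (\<Sum>l<k. \<Sum>t<q. A $$ (i * q + r, l * q + t) * B $$ (l * q + t, j * q + c))"
    if "r < q" "c < q" for r c
  proof -
    have "(A * B) $$ (i * q + r, j * q + c)
      = (\<Sum>t<k * q. A $$ (i * q + r, t) * B $$ (t, j * q + c))"
      using A B block_index[OF ij(1) that(1)] block_index[OF ij(2) that(2)]
      by (auto simp: scalar_prod_def atLeast0LessThan)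
    also have "\<dots> = (\<Sum>l<k. \<Sum>t\<in>{l * q..<l * q + q}. A $$ (i * q + r, t) * B $$ (t, j * q + c))"
      by (rule sum.nat_group[symmetric])
    also have "\<dots> = (\<Sum>l<k. \<Sum>t<q. A $$ (i * q + r, l * q + t) * B $$ (l * q + t, j * q + c))"
      by (simp only: shift)
    finally show ?thesis .
  qed
  show ?thesis
  proof (rule opair_eqI; rule ext)
    fix x p
    have "act (blk q (A * B) i j) x p = (\<Sum>r<q. \<Sum>l<k. \<Sum>t<q.
        A $$ (i * q + p mod q, l * q + t) * B $$ (l * q + t, j * q + r) * x (p div q * q + r))"
      using q by (simp add: act_blk e sum_distrib_right)
    also have "\<dots> = (\<Sum>l<k. \<Sum>t<q. \<Sum>r<q.
        A $$ (i * q + p mod q, l * q + t) * B $$ (l * q + t, j * q + r) * x (p div q * q + r))"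
      by (subst sum.swap) (intro sum.cong refl sum.swap)
    also have "\<dots> = act (\<Sum>l<k. blk q A i l * blk q B l j) x p"
      by (simp add: act_sum act_mult act_blk sum_distrib_left mult.assoc)
    finally show "act (blk q (A * B) i j) x p = act (\<Sum>l<k. blk q A i l * blk q B l j) x p" .
    have "act (star (blk q (A * B) i j)) x p = (\<Sum>r<q. \<Sum>l<k. \<Sum>t<q.
        cnj (A $$ (i * q + r, l * q + t)) * cnj (B $$ (l * q + t, j * q + p mod q)) * x (p div q * q + r))"
      using q by (simp add: act_star_blk e sum_distrib_right)
    also have "\<dots> = (\<Sum>l<k. \<Sum>t<q. \<Sum>r<q.
        cnj (A $$ (i * q + r, l * q + t)) * cnj (B $$ (l * q + t, j * q + p mod q)) * x (p div q * q + r))"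
      by (subst sum.swap) (intro sum.cong refl sum.swap)
    also have "\<dots> = act (star (\<Sum>l<k. blk q A i l * blk q B l j)) x p"
      by (simp add: star_sum star_mult act_sum act_mult act_star_blk sum_distrib_left mult.assoc mult.left_commute)
    finally show "act (star (blk q (A * B) i j)) x p
        = act (star (\<Sum>l<k. blk q A i l * blk q B l j)) x p" .
  qed
qed

lemma mat_adjoint_carrier [simp]:
  "A \<in> carrier_mat m k \<Longrightarrow> mat_adjoint A \<in> carrier_mat k m"
  by (simp add: mat_adjoint_def mat_of_rows_def)

lemma blk_adjoint:
  assumes "q > 0" "A \<in> carrier_mat (m * q) (k * q)" "i < m" "j < k"
  shows "blk q (mat_adjoint A) j i = star (blk q A i j)"
proof -
  have e: "mat_adjoint A $$ (j * q + c, i * q + r) = cnj (A $$ (i * q + r, j * q + c))"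
    if "r < q" "c < q" for r c
    using assms block_index[OF assms(3) that(1)] block_index[OF assms(4) that(2)]
    by (simp add: mat_adjoint_def mat_of_rows_def)
  show ?thesis
    by (rule opair_eqI) (use assms(1) e in \<open>auto simp: fun_eq_iff act_blk act_star_blk\<close>)
qed

lemma block_mat_carrier [simp]: "block_mat q m k f \<in> carrier_mat (m * q) (k * q)"
  by (simp add: block_mat_def)

lemma blk_block_mat:
  assumes "q > 0" "i < m" "j < k"
  shows "blk q (block_mat q m k f) i j = blk q (f i j) 0 0"
  by (rule blk_eqI)
     (use assms block_index[of i m _ q] block_index[of j k _ q] in \<open>auto simp: block_mat_def\<close>)

lemma hcat_carrier [simp]:
  "A \<in> carrier_mat m k \<Longrightarrow> B \<in> carrier_mat m k' \<Longrightarrow> hcat A B \<in> carrier_mat m (k + k')"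
  by (simp add: hcat_def)

lemma blk_hcat:
  assumes q: "q > 0" and A: "A \<in> carrier_mat q (k * q)" and B: "B \<in> carrier_mat q q" and j: "j \<le> k"
  shows "blk q (hcat A B) 0 j = (if j < k then blk q A 0 j else blk q B 0 0)"
proof (cases "j < k")
  case True
  have "blk q (hcat A B) 0 j = blk q A 0 j"
    by (rule blk_eqI)
       (use q A B block_index[OF True, of _ q] in \<open>auto simp: hcat_def trans_less_add1\<close>)
  with True show ?thesis by simp
next
  case False
  with j have "j = k" by simp
  have "blk q (hcat A B) 0 k = blk q B 0 0"
    by (rule blk_eqI) (use q A B in \<open>auto simp: hcat_def\<close>)
  with \<open>j = k\<close> show ?thesis by simp
qed

lemma blk_four_block:
  assumes "q > 0" "A \<in> carrier_mat q q" "B \<in> carrier_mat q q" "C \<in> carrier_mat q q" "E \<in> carrier_mat q q"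
  shows "blk q (four_block_mat A B C E) 0 0 = blk q A 0 0"
    "blk q (four_block_mat A B C E) 0 (Suc 0) = blk q B 0 0"
    "blk q (four_block_mat A B C E) (Suc 0) 0 = blk q C 0 0"
    "blk q (four_block_mat A B C E) (Suc 0) (Suc 0) = blk q E 0 0"
  by (rule blk_eqI; use assms in auto)+

section \<open>Invertible complex matrices\<close>

lemma minv_inverse:
  assumes A: "A \<in> carrier_mat m m" and "invertible_mat A"
  shows "minv A \<in> carrier_mat m m" "A * minv A = 1\<^sub>m m" "minv A * A = 1\<^sub>m m"
proof -
  from assms obtain B where B: "A * B = 1\<^sub>m m" "B * A = 1\<^sub>m (dim_row B)"
    unfolding invertible_mat_def inverts_mat_def by auto
  have "dim_col (A * B) = m" "dim_col (B * A) = dim_row B" unfolding B by simp_all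
  then have "B \<in> carrier_mat m m" using A by (auto intro: carrier_matI)
  then have "\<exists>B. B \<in> carrier_mat (dim_row A) (dim_row A) \<and> A * B = 1\<^sub>m (dim_row A) \<and> B * A = 1\<^sub>m (dim_row A)"
    using A B by auto
  from someI_ex[OF this] show "minv A \<in> carrier_mat m m" "A * minv A = 1\<^sub>m m" "minv A * A = 1\<^sub>m m"
    using A unfolding minv_def by auto
qed

lemma invertible_mat_if_det_nonzero:
  assumes A: "A \<in> carrier_mat m m" and "det A \<noteq> (0 :: complex)"
  shows "invertible_mat A"
proof -
  from det_non_zero_imp_unit[OF assms] obtain B
    where "B \<in> carrier_mat m m" "B * A = 1\<^sub>m m" "A * B = 1\<^sub>m m"
    by (auto simp: Units_def ring_mat_def)
  then show ?thesis using A unfolding invertible_mat_def inverts_mat_def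
    by (metis carrier_matD square_mat.simps)
qed

lemma invertible_mat_if_trivial_kernel:
  assumes A: "A \<in> carrier_mat m m"
    and "\<And>v. v \<in> carrier_vec m \<Longrightarrow> A *\<^sub>v v = 0\<^sub>v m \<Longrightarrow> v = 0\<^sub>v m"
  shows "invertible_mat (A :: complex mat)"
  using assms det_0_iff_vec_prod_zero_field[OF A] invertible_mat_if_det_nonzero[OF A] by blast

text \<open>A left inverse in the operator ring, not assumed to come from a matrix, is enough for
  invertibility.\<close>

lemma blk_minv:
  assumes q: "q > 0" and A: "A \<in> carrier_mat q q" and c: "c * blk q A 0 0 = 1"
  shows "invertible_mat A" "blk q (minv A) 0 0 = c" "blk q A 0 0 * c = 1"
proof -
  show inv: "invertible_mat A"
  proof (rule invertible_mat_if_trivial_kernel[OF A])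
    fix v assume v: "v \<in> carrier_vec q" "A *\<^sub>v v = 0\<^sub>v q"
    \<comment> \<open>A kernel vector is extended by zero to a sequence; its image vanishes on every
      segment, so the left inverse \<open>c\<close> forces it to be zero.\<close>
    define x where "x p = (if p < q then v $ p else 0)" for p
    have "act (blk q A 0 0) x p = 0" for p
    proof (cases "p < q")
      case True
      then have "act (blk q A 0 0) x p = (A *\<^sub>v v) $ p"
        using A v(1) by (simp add: act_blk x_def scalar_prod_def atLeast0LessThan)
      then show ?thesis using v True by simp
    next
      case False
      then have "p div q \<ge> 1" using q by (simp add: div_greater_zero_iff Suc_le_eq)
      then have "\<not> p div q * q + r < q" for r by (cases "p div q") auto
      then show ?thesis by (simp add: act_blk x_def)
    qed
    then have "act (blk q A 0 0) x = (\<lambda>p. 0)" by auto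
    moreover have "act c (act (blk q A 0 0) x) = x" using c by (metis act_mult act_one)
    ultimately have "x = (\<lambda>p. 0)" by (simp add: act_null)
    then have "x p = 0" for p by simp
    then show "v = 0\<^sub>v q" using v(1) by (auto simp: x_def intro!: eq_vecI) (metis)
  qed
  note m = minv_inverse[OF A inv]
  have "blk q A 0 0 * blk q (minv A) 0 0 = 1"
    using blk_mult[of q A 1 1 "minv A" 1 0 0] q A m blk_one[of q 0 1 0] by simp
  then show *: "blk q (minv A) 0 0 = c" using c by (metis mult.assoc mult_1_left mult_1_right)
  show "blk q A 0 0 * c = 1"
    using \<open>blk q A 0 0 * blk q (minv A) 0 0 = 1\<close> unfolding * .
qed

subsection \<open>The polynomials and parameters in the star ring\<close>

text \<open>A kernel vector of the leading section, padded with zeros, would be a null vector of the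
  positive definite form.\<close>

lemma pos_def_leading_invertible:
  assumes A: "A \<in> carrier_mat m m" "pos_def A" and B: "B \<in> carrier_mat k k" and k: "k \<le> m"
    and eq: "\<And>i j. i < k \<Longrightarrow> j < k \<Longrightarrow> B $$ (i, j) = A $$ (i, j)"
  shows "invertible_mat B"
proof (rule invertible_mat_if_trivial_kernel[OF B])
  fix v assume v: "v \<in> carrier_vec k" and Bv: "B *\<^sub>v v = 0\<^sub>v k"
  define u where "u = vec m (\<lambda>i. if i < k then v $ i else 0)"
  have u: "u \<in> carrier_vec m" by (simp add: u_def)
  have Au: "(A *\<^sub>v u) $ i = 0" if i: "i < k" for i
  proof -
    have "(A *\<^sub>v u) $ i = (\<Sum>j<m. A $$ (i, j) * (if j < k then v $ j else 0))"
      using A(1) i k by (simp add: u_def scalar_prod_def atLeast0LessThan)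
    also have "\<dots> = (\<Sum>j<k. A $$ (i, j) * v $ j)"
      by (rule sum.mono_neutral_cong_right) (use k in auto)
    also have "\<dots> = (B *\<^sub>v v) $ i"
      using B v i eq by (simp add: scalar_prod_def atLeast0LessThan)
    finally show ?thesis using Bv i by simp
  qed
  have "(A *\<^sub>v u) \<bullet>c u = (\<Sum>i<m. (A *\<^sub>v u) $ i * cnj (u $ i))"
    using u by (simp add: scalar_prod_def atLeast0LessThan)
  also have "\<dots> = 0" using Au by (intro sum.neutral) (auto simp: u_def)
  finally have "u = 0\<^sub>v m"
    using A u unfolding pos_def_def by (metis carrier_matD(1) less_irrefl zero_complex.sel(1))
  then have "u $ i = 0" if "i < k" for i using that k by simp
  then show "v = 0\<^sub>v k" using v k by (intro eq_vecI) (auto simp: u_def)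
qed

lemma block_mat_leading_invertible:
  assumes q: "q > 0" and "pos_def (block_mat q m m f)" and k: "k \<le> m"
  shows "invertible_mat (block_mat q k k f)"
proof (rule pos_def_leading_invertible[OF block_mat_carrier assms(2) block_mat_carrier])
  fix i j assume ij: "i < k * q" "j < k * q"
  moreover have "k * q \<le> m * q" using k by simp
  ultimately have "i < m * q" "j < m * q" by linarith+
  with ij show "block_mat q k k f $$ (i, j) = block_mat q m m f $$ (i, j)"
    by (simp add: block_mat_def)
qed (use k in auto)

text \<open>A Hankel matrix of size \<open>k\<close> contains only the first
  \<open>2 * k - 1\<close> moments, hence the bound on \<open>i\<close>.\<close>

lemma hinv_blk_minv:
  assumes q: "q > 0" and inv: "invertible_mat (block_mat q k k (\<lambda>l i. f (l + i)))"
    and \<kappa>: "\<And>i. Suc i < 2 * k \<Longrightarrow> blk q (f i) 0 0 = \<kappa> i"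
  shows "hinv \<kappa> k (blk q (minv (block_mat q k k (\<lambda>l i. f (l + i)))))"
proof -
  let ?H = "block_mat q k k (\<lambda>l i. f (l + i))"
  note m = minv_inverse[OF block_mat_carrier inv]
  have H: "blk q ?H l i = \<kappa> (l + i)" if "l < k" "i < k" for l i
    using that \<kappa>[of "l + i"] by (simp add: blk_block_mat[OF q])
  show ?thesis unfolding hinv_def
  proof (intro allI impI conjI)
    fix l i assume li: "l < k" "i < k"
    have "(\<Sum>r<k. blk q ?H l r * blk q (minv ?H) r i) = (if l = i then 1 else 0)"
      unfolding blk_mult[OF q block_mat_carrier m(1) li, symmetric] m(2) by (rule blk_one[OF q li])
    then show "(\<Sum>r<k. \<kappa> (l + r) * blk q (minv ?H) r i) = (if l = i then 1 else 0)"
      using li by (simp add: H)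
    have "(\<Sum>r<k. blk q (minv ?H) l r * blk q ?H r i) = (if l = i then 1 else 0)"
      unfolding blk_mult[OF q m(1) block_mat_carrier li, symmetric] m(3) by (rule blk_one[OF q li])
    then show "(\<Sum>r<k. blk q (minv ?H) l r * \<kappa> (r + i)) = (if l = i then 1 else 0)"
      using li by (simp add: H)
  qed
qed

section \<open>Resolvents and the block forms of polynomials and parameters\<close>

lemma Tm_carrier [simp]: "Tm q j \<in> carrier_mat (Suc j * q) (Suc j * q)"
  unfolding Tm_def using block_mat_carrier[of q "j + 1" "j + 1"] by simp

text \<open>The matrix is lower triangular with unit diagonal, so its determinant is one.\<close>

lemma Rm_inverse:
  assumes q: "q > 0"
  shows "Rm q j z \<in> carrier_mat (Suc j * q) (Suc j * q)"
    "(1\<^sub>m (Suc j * q) - z \<cdot>\<^sub>m Tm q j) * Rm q j z = 1\<^sub>m (Suc j * q)"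
proof -
  let ?A = "1\<^sub>m (Suc j * q) - z \<cdot>\<^sub>m Tm q j"
  have A: "?A \<in> carrier_mat (Suc j * q) (Suc j * q)"
    using Tm_carrier by (intro minus_carrier_mat smult_carrier_mat)
  have T0: "Tm q j $$ (i, k) = 0" if "i \<le> k" "k < Suc j * q" for i k
  proof -
    have "i div q \<le> k div q" using that by (simp add: div_le_mono)
    with that q show ?thesis by (simp add: Tm_def block_mat_def)
  qed
  have "det ?A = prod_list (diag_mat ?A)"
    by (rule det_lower_triangular[OF _ A]) (use Tm_carrier[of q j] T0 in auto)
  also have "diag_mat ?A = map (\<lambda>i. 1) [0..<Suc j * q]"
    unfolding diag_mat_def using A Tm_carrier[of q j] T0 by (intro map_cong) auto
  finally have "det ?A \<noteq> 0" by (simp add: map_replicate_const)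
  from minv_inverse[OF A invertible_mat_if_det_nonzero[OF A this]] show "Rm q j z \<in> carrier_mat (Suc j * q) (Suc j * q)"
    "?A * Rm q j z = 1\<^sub>m (Suc j * q)" by (simp_all add: Rm_def)
qed

text \<open>Read blockwise, \<open>(I - z T) x = w\<close> is the stated recursion, so applying the
  resolvent means solving it forward. Each vector is then handled by naming its sequence
  \<open>x\<close>.\<close>

lemma blk_Rm_mult:
  assumes q: "q > 0" and w: "w \<in> carrier_mat (Suc j * q) q"
    and x0: "x 0 = blk q w 0 0"
    and xS: "\<And>l. l < j \<Longrightarrow> x (Suc l) = scal z * x l + blk q w (Suc l) 0"
    and l: "l \<le> j"
  shows "blk q (Rm q j z * w) l 0 = x l"
proof -
  let ?A = "1\<^sub>m (Suc j * q) - z \<cdot>\<^sub>m Tm q j"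
  note R = Rm_inverse[OF q, of j z]
  have w': "w \<in> carrier_mat (Suc j * q) (1 * q)" using w by simp
  have y: "Rm q j z * w \<in> carrier_mat (Suc j * q) (1 * q)" using R(1) w' by simp
  have A: "?A \<in> carrier_mat (Suc j * q) (Suc j * q)"
    using Tm_carrier by (intro minus_carrier_mat smult_carrier_mat)
  have Aw: "?A * (Rm q j z * w) = w"
    using assoc_mult_mat[OF A R(1) w] R(2) w by simp
  have blkA: "blk q ?A i k = (if i = k then 1 else 0) - scal z * (if i = Suc k then 1 else 0)"
    if "i < Suc j" "k < Suc j" for i k
  proof -
    have "blk q (Tm q j) i k = (if i = Suc k then 1 else 0)"
      using that blk_one[OF q, of 0 1 0] blk_zero[OF q, of 0 1 0 1] unfolding Tm_def
      by (simp add: blk_block_mat[OF q])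
    then show ?thesis using that
      by (simp only: blk_diff[OF q one_carrier_mat smult_carrier_mat[OF Tm_carrier]]
          blk_smult[OF q Tm_carrier] blk_one[OF q])
  qed
  have rec: "blk q w i 0 = (\<Sum>k<Suc j. ((if i = k then 1 else 0) - scal z * (if i = Suc k then 1 else 0))
      * blk q (Rm q j z * w) k 0)" if "i < Suc j" for i
  proof -
    have "blk q w i 0 = (\<Sum>k<Suc j. blk q ?A i k * blk q (Rm q j z * w) k 0)"
      using blk_mult[OF q A y that, of 0] unfolding Aw by simp
    also have "\<dots> = (\<Sum>k<Suc j. ((if i = k then 1 else 0) - scal z * (if i = Suc k then 1 else 0))
      * blk q (Rm q j z * w) k 0)"
      by (rule sum.cong[OF refl]) (simp only: blkA[OF that] lessThan_iff)
    finally show ?thesis .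
  qed
  show ?thesis using l
  proof (induction l)
    case 0
    have "blk q w 0 0 = (\<Sum>k<Suc j. (if k = 0 then blk q (Rm q j z * w) k 0 else 0))"
      unfolding rec[OF zero_less_Suc] by (rule sum.cong) auto
    then show ?case by (simp add: x0 sum.delta)
  next
    case (Suc l)
    have "blk q w (Suc l) 0 = (\<Sum>k<Suc j. (if k = Suc l then blk q (Rm q j z * w) k 0 else 0)
        - (if k = l then scal z * blk q (Rm q j z * w) k 0 else 0))"
      unfolding rec[OF Suc_le_lessD[OF Suc_le_mono[THEN iffD2, OF Suc.prems]]]
      by (rule sum.cong) (auto simp: left_diff_distrib)
    also have "\<dots> = blk q (Rm q j z * w) (Suc l) 0 - scal z * blk q (Rm q j z * w) l 0"
      using Suc.prems by (simp add: sum_subtractf sum.delta del: sum.lessThan_Suc)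
    finally show ?case using Suc xS[of l] by simp
  qed
qed

text \<open>Common form of all six polynomials: \<open>f\<close> fixes the weight, \<open>w\<close>
  the kind. Moments up to index \<open>2 * j - 1\<close> enter, one beyond the Hankel matrix,
  because of the \<open>Y\<close> column.\<close>

lemma blk_orthogonal_poly:
  assumes q: "q > 0" and w: "w \<in> carrier_mat (Suc j * q) q"
    and inv: "invertible_mat (block_mat q j j (\<lambda>l i. f (l + i)))"
    and \<kappa>: "\<And>i. i < 2 * j \<Longrightarrow> blk q (f i) 0 0 = \<kappa> i" "\<And>i. star (\<kappa> i) = \<kappa> i"
    and x0: "x 0 = blk q w 0 0"
    and xS: "\<And>l. l < j \<Longrightarrow> x (Suc l) = scal z * x l + blk q w (Suc l) 0"
  defines "H \<equiv> block_mat q j j (\<lambda>l i. f (l + i))"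
  defines "p \<equiv> hcat (- (mat_adjoint (block_mat q j 1 (\<lambda>l k. f (j + l))) * minv H)) (1\<^sub>m q) * Rm q j z * w"
  shows "p \<in> carrier_mat q q" "blk q p 0 0 = OP \<kappa> (blk q (minv H)) j x"
proof -
  let ?Y = "block_mat q j 1 (\<lambda>l k. f (j + l))"
  note R = Rm_inverse(1)[OF q, of j z]
  have w': "w \<in> carrier_mat (Suc j * q) (1 * q)" using w by simp
  have Rw: "Rm q j z * w \<in> carrier_mat (Suc j * q) (1 * q)" using R w' by simp
  have J: "minv H \<in> carrier_mat (j * q) (j * q)"
    unfolding H_def by (rule minv_inverse[OF block_mat_carrier inv])
  have Y: "mat_adjoint ?Y \<in> carrier_mat (1 * q) (j * q)" by (intro mat_adjoint_carrier block_mat_carrier)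
  have YJ: "mat_adjoint ?Y * minv H \<in> carrier_mat (1 * q) (j * q)" using Y J by simp
  let ?h = "hcat (- (mat_adjoint ?Y * minv H)) (1\<^sub>m q)"
  have "?h \<in> carrier_mat q (j * q + q)" using YJ by (intro hcat_carrier) auto
  then have h: "?h \<in> carrier_mat (1 * q) (Suc j * q)" by (simp add: add.commute)
  have p: "p = ?h * (Rm q j z * w)" unfolding p_def using h R w by (simp add: assoc_mult_mat)
  show "p \<in> carrier_mat q q" unfolding p using h Rw by simp
  have blkh: "blk q ?h 0 i = (if i < j then - (\<Sum>l<j. \<kappa> (j + l) * blk q (minv H) l i) else 1)"
    if "i < Suc j" for i
  proof (cases "i < j")
    case True
    have "blk q ?h 0 i = - blk q (mat_adjoint ?Y * minv H) 0 i"
      using blk_hcat[OF q, of "- (mat_adjoint ?Y * minv H)" j "1\<^sub>m q" i] YJ True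
        blk_uminus[OF q YJ, of 0 i] by simp
    also have "blk q (mat_adjoint ?Y * minv H) 0 i = (\<Sum>l<j. blk q (mat_adjoint ?Y) 0 l * blk q (minv H) l i)"
      using blk_mult[OF q Y J, of 0 i] True by simp
    also have "\<dots> = (\<Sum>l<j. \<kappa> (j + l) * blk q (minv H) l i)"
      by (intro sum.cong refl)
         (simp add: blk_adjoint[OF q block_mat_carrier, of _ _ 0] blk_block_mat[OF q] \<kappa>)
    finally show ?thesis using True by simp
  next
    case False
    then have "i = j" using that by simp
    then show ?thesis
      using blk_hcat[OF q, of "- (mat_adjoint ?Y * minv H)" j "1\<^sub>m q" j] YJ blk_one[OF q, of 0 1 0]
      by simp
  qed
  have "blk q p 0 0 = (\<Sum>i<Suc j. blk q ?h 0 i * blk q (Rm q j z * w) i 0)"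
    unfolding p using blk_mult[OF q h Rw] by simp
  also have "\<dots> = (\<Sum>i<Suc j. (if i < j then - (\<Sum>l<j. \<kappa> (j + l) * blk q (minv H) l i) else 1) * x i)"
    by (intro sum.cong refl) (use blkh blk_Rm_mult[where x = x, OF q w x0 xS] in simp)
  also have "\<dots> = OP \<kappa> (blk q (minv H)) j x"
    by (simp add: OP_def ker_def sum_negf)
  finally show "blk q p 0 0 = OP \<kappa> (blk q (minv H)) j x" .
qed

text \<open>Common form of \<open>lam\<close> and \<open>mu\<close>; since \<open>x\<close> is
  self-adjoint, the adjoint row has the same blocks as the column.\<close>

lemma blk_kernel_form:
  assumes q: "q > 0" and w: "w \<in> carrier_mat (Suc j * q) q"
    and J: "J \<in> carrier_mat (Suc j * q) (Suc j * q)"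
    and x0: "x 0 = blk q w 0 0"
    and xS: "\<And>l. l < j \<Longrightarrow> x (Suc l) = scal z * x l + blk q w (Suc l) 0"
    and xh: "\<And>l. star (x l) = x l"
  defines "p \<equiv> mat_adjoint w * mat_adjoint (Rm q j z) * J * Rm q j z * w"
  shows "p \<in> carrier_mat q q" "blk q p 0 0 = ker (blk q J) (Suc j) x x"
proof -
  note R = Rm_inverse(1)[OF q, of j z]
  have w': "w \<in> carrier_mat (Suc j * q) (1 * q)" using w by simp
  have Rw: "Rm q j z * w \<in> carrier_mat (Suc j * q) (1 * q)" using R w' by simp
  let ?L = "mat_adjoint w * mat_adjoint (Rm q j z)"
  have L: "?L \<in> carrier_mat (1 * q) (Suc j * q)" using w' R by (meson mat_adjoint_carrier mult_carrier_mat)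
  have LJ: "?L * J \<in> carrier_mat (1 * q) (Suc j * q)" using L J by simp
  have p: "p = ?L * J * (Rm q j z * w)" unfolding p_def using LJ R w by (simp add: assoc_mult_mat)
  show "p \<in> carrier_mat q q" unfolding p using LJ Rw by simp
  have y: "blk q (Rm q j z * w) i 0 = x i" if "i < Suc j" for i
    using blk_Rm_mult[where x = x, OF q w x0 xS] that by simp
  have bL: "blk q ?L 0 i = x i" if "i < Suc j" for i
  proof -
    have "blk q ?L 0 i = (\<Sum>l<Suc j. blk q (mat_adjoint w) 0 l * blk q (mat_adjoint (Rm q j z)) l i)"
      by (rule blk_mult[OF q mat_adjoint_carrier[OF w'] mat_adjoint_carrier[OF R] _ that]) simp
    also have "\<dots> = (\<Sum>l<Suc j. star (blk q (Rm q j z) i l * blk q w l 0))"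
      by (intro sum.cong refl)
         (simp add: blk_adjoint[OF q w', of _ 0] blk_adjoint[OF q R that] star_mult)
    also have "\<dots> = star (blk q (Rm q j z * w) i 0)"
      using blk_mult[OF q R w' that, of 0] by (simp only: star_sum)
    finally show ?thesis using y[OF that] xh by simp
  qed
  have "blk q p 0 0 = (\<Sum>i<Suc j. blk q (?L * J) 0 i * blk q (Rm q j z * w) i 0)"
    unfolding p using blk_mult[OF q LJ Rw] by simp
  also have "\<dots> = (\<Sum>i<Suc j. (\<Sum>l<Suc j. x l * blk q J l i) * x i)"
  proof (intro sum.cong refl)
    fix i assume i: "i \<in> {..<Suc j}"
    have "blk q (?L * J) 0 i = (\<Sum>l<Suc j. blk q ?L 0 l * blk q J l i)"
      using blk_mult[OF q L J, of 0 i] i by simp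
    also have "\<dots> = (\<Sum>l<Suc j. x l * blk q J l i)"
      by (intro sum.cong refl) (simp add: bL)
    finally show "blk q (?L * J) 0 i * blk q (Rm q j z * w) i 0 = (\<Sum>l<Suc j. x l * blk q J l i) * x i"
      using y i by simp
  qed
  finally show "blk q p 0 0 = ker (blk q J) (Suc j) x x" by (simp add: ker_def)
qed

lemma foldr_mult_carrier:
  assumes "\<And>k. A k \<in> carrier_mat d d" "B \<in> carrier_mat d d"
  shows "foldr (\<lambda>k M. A k * M) xs B \<in> carrier_mat d d"
  by (induction xs) (simp_all add: assms mult_carrier_mat[OF assms(1)])

lemma ordprod_carrier: "(\<And>k. A k \<in> carrier_mat d d) \<Longrightarrow> ordprod d A n \<in> carrier_mat d d"
  unfolding ordprod_def by (rule foldr_mult_carrier) auto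

lemma ordprod_0: "A 0 \<in> carrier_mat d d \<Longrightarrow> ordprod d A 0 = A 0"
  by (simp add: ordprod_def)

text \<open>The right fold peels off the first factor, while the partial-product recursions need the
  last one.\<close>

lemma ordprod_Suc:
  assumes A: "\<And>k. A k \<in> carrier_mat d d"
  shows "ordprod d A (Suc n) = ordprod d A n * A (Suc n)"
proof -
  have "foldr (\<lambda>k M. A k * M) xs B = foldr (\<lambda>k M. A k * M) xs (1\<^sub>m d) * B"
    if B: "B \<in> carrier_mat d d" for xs B
  proof (induction xs)
    case (Cons k xs)
    have c: "foldr (\<lambda>k M. A k * M) xs (1\<^sub>m d) \<in> carrier_mat d d"
      by (rule foldr_mult_carrier[OF A]) simp
    show ?case using Cons assoc_mult_mat[OF A c B, of k] by simp
  qed (use B in simp)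
  from this[OF A[of "Suc n"], of "[0..<Suc n]"] show ?thesis
    using A[of "Suc n"] by (simp add: ordprod_def del: upt_Suc) (simp add: upt_Suc)
qed

section \<open>The moment blocks as an instance of the abstract recursion\<close>

locale hausdorff_moments =
  fixes q n :: nat and a b :: real and s :: "nat \<Rightarrow> complex mat"
  assumes q: "0 < q" and n: "1 \<le> n"
    and s_dim: "\<And>j. j \<le> 2 * n + 1 \<Longrightarrow> s j \<in> carrier_mat q q"
    and s_herm: "\<And>j. j \<le> 2 * n + 1 \<Longrightarrow> hermitian (s j)"
    and H1: "pos_def (H1 q s n)" and H2: "pos_def (H2 q a b s (n - 1))"
    and K1: "pos_def (K1 q b s n)"
    and P1a: "invertible_mat (P1 q s (n + 1) (of_real a))"
begin

text \<open>Moments of index beyond \<open>2n + 1\<close> are unconstrained, so they are cut off.\<close>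

definition S :: "nat \<Rightarrow> opair" where
  "S j = (if j \<le> 2 * n + 1 then blk q (s j) 0 0 else 0)"

abbreviation Ka where "Ka j \<equiv> complex_of_real b \<cdot>\<^sub>m s j - s (j + 1)"

definition J1 where "J1 k = blk q (minv (block_mat q k k (\<lambda>l i. Ka (l + i))))"
definition J2 where "J2 k = blk q (minv (block_mat q k k (\<lambda>l i. shat a b s (l + i))))"

lemma star_S: "star (S j) = S j"
proof (cases "j \<le> 2 * n + 1")
  case True
  have "s j \<in> carrier_mat (1 * q) (1 * q)" using s_dim[OF True] by simp
  from blk_adjoint[OF q this, of 0 0] s_herm[OF True] show ?thesis
    using True by (simp add: S_def hermitian_def)
qed (simp add: S_def)

lemma blk_s: "j \<le> 2 * n + 1 \<Longrightarrow> blk q (s j) 0 0 = S j"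
  by (simp add: S_def)

lemma blk1_add: "A \<in> carrier_mat q q \<Longrightarrow> B \<in> carrier_mat q q \<Longrightarrow> blk q (A + B) 0 0 = blk q A 0 0 + blk q B 0 0"
  using blk_add[OF q, of A 1 1 B 0 0] by simp
lemma blk1_diff: "A \<in> carrier_mat q q \<Longrightarrow> B \<in> carrier_mat q q \<Longrightarrow> blk q (A - B) 0 0 = blk q A 0 0 - blk q B 0 0"
  using blk_diff[OF q, of A 1 1 B 0 0] by simp
lemma blk1_uminus: "A \<in> carrier_mat q q \<Longrightarrow> blk q (- A) 0 0 = - blk q A 0 0"
  using blk_uminus[OF q, of A 1 1 0 0] by simp
lemma blk1_smult: "A \<in> carrier_mat q q \<Longrightarrow> blk q (c \<cdot>\<^sub>m A) 0 0 = scal c * blk q A 0 0"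
  using blk_smult[OF q, of A 1 1 0 0 c] by simp
lemma blk1_mult: "A \<in> carrier_mat q q \<Longrightarrow> B \<in> carrier_mat q q \<Longrightarrow> blk q (A * B) 0 0 = blk q A 0 0 * blk q B 0 0"
  using blk_mult[OF q, of A 1 1 B 1 0 0] by simp
lemma blk1_adjoint: "A \<in> carrier_mat q q \<Longrightarrow> blk q (mat_adjoint A) 0 0 = star (blk q A 0 0)"
  using blk_adjoint[OF q, of A 1 1 0 0] by simp
lemma blk1_one: "blk q (1\<^sub>m q) 0 0 = 1"
  using blk_one[OF q, of 0 1 0] by simp
lemma blk1_zero: "blk q (0\<^sub>m q q) 0 0 = 0"
  using blk_zero[OF q, of 0 1 0 1] by simp
lemmas blk1 = blk1_add blk1_diff blk1_uminus blk1_smult blk1_mult blk1_adjoint blk1_one blk1_zero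

text \<open>Stands in for \<open>rho\<close> until the sublocale provides it; \<open>rho'_eq\<close>
  identifies the two.\<close>

definition rho' where "rho' j = scal b * S j - S (Suc j)"

lemma blk_Ka: "j < 2 * n + 1 \<Longrightarrow> blk q (Ka j) 0 0 = rho' j"
  using s_dim[of j] s_dim[of "Suc j"] by (simp add: blk1 blk_s rho'_def)

lemma shat_carrier: "j < 2 * n \<Longrightarrow> shat a b s j \<in> carrier_mat q q"
  unfolding shat_def using s_dim[of j] s_dim[of "j + 1"] s_dim[of "j + 2"]
  by (intro minus_carrier_mat add_carrier_mat smult_carrier_mat) auto

text \<open>Reflects the factorisation of the weight as \<open>(b - t) * (t - a)\<close>.\<close>

lemma blk_shat: "j < 2 * n \<Longrightarrow> blk q (shat a b s j) 0 0 = D (scal a) rho' j"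
  using s_dim[of j] s_dim[of "Suc j"] s_dim[of "Suc (Suc j)"]
  by (simp add: shat_def blk1 blk_s rho'_def D_def scal_mult scal_add scal_uminus algebra_simps)

lemma inv_Ka: "k \<le> Suc n \<Longrightarrow> invertible_mat (block_mat q k k (\<lambda>l i. Ka (l + i)))"
  using block_mat_leading_invertible[OF q K1[unfolded K1_def], of k] by simp

lemma inv_shat: "k \<le> n \<Longrightarrow> invertible_mat (block_mat q k k (\<lambda>l i. shat a b s (l + i)))"
  using block_mat_leading_invertible[OF q H2[unfolded H2_def], of k] n by simp

lemma inv_s: "k \<le> Suc n \<Longrightarrow> invertible_mat (block_mat q k k (\<lambda>l i. s (l + i)))"
  using block_mat_leading_invertible[OF q H1[unfolded H1_def], of k] by simp

sublocale hausdorff_ring "scal a" "scal b" S n J1 J2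
proof
  fix k
  show "hinv (\<lambda>j. scal b * S j - S (Suc j)) k (J1 k)" if "k \<le> Suc n"
    unfolding J1_def rho'_def[symmetric, abs_def]
    by (rule hinv_blk_minv[OF q inv_Ka[OF that]]) (use that blk_Ka in auto)
  show "hinv (D (scal a) (\<lambda>j. scal b * S j - S (Suc j))) k (J2 k)" if "k \<le> n"
    unfolding J2_def rho'_def[symmetric, abs_def]
    by (rule hinv_blk_minv[OF q inv_shat[OF that]]) (use that blk_shat in auto)
qed (simp_all add: central_scal star_scal star_S)

lemma rho'_eq: "rho' = rho"
  by (simp add: fun_eq_iff rho'_def rho_def)

section \<open>Block values of the parameters and polynomials\<close>

lemma blk_vv: "l \<le> j \<Longrightarrow> blk q (vv q j) l 0 = (if l = 0 then 1 else 0)"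
  unfolding vv_def using blk_block_mat[OF q, of l "j + 1" 0 1] by (simp add: blk1)

lemma vv_carrier: "vv q j \<in> carrier_mat (Suc j * q) q"
  unfolding vv_def using block_mat_carrier[of q "j + 1" 1] by simp

lemma J1_eq: "J1 (Suc j) = blk q (minv (K1 q b s j))"
  by (simp add: J1_def K1_def)

lemma J2_eq: "J2 (Suc j) = blk q (minv (H2 q a b s j))"
  by (simp add: J2_def H2_def)

text \<open>The sequence that starts at \<open>S 0\<close> and obeys
  \<open>y (i + 1) = c y i - rho i\<close>; it encodes the resolvent applied to
  \<open>ut1\<close>.\<close>

abbreviation y where "y c \<equiv> D (scal b) (hseq S (scal c))"

lemma D_y_0: "D (scal a) (y c) 0 = - scal (a + b) * S 0 + S 1 + scal c * S 0"
  by (simp add: D_def algebra_simps scal_add)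

lemma D_y_Suc: "D (scal a) (y c) (Suc i) = scal c * D (scal a) (y c) i - D (scal a) rho i"
proof -
  have e: "scal c * (scal a * u) = scal a * (scal c * u)" for u
    by (rule central_left_commute[OF central_scal])
  have y: "y c (Suc i) = scal c * y c i - rho i"
    using fun_cong[OF D_D_hseq[OF central_scal, of c], of i] by (simp add: D_def algebra_simps)
  show ?thesis unfolding D_D_hseq[OF central_scal] y
    by (simp add: D_def e algebra_simps)
qed

lemma w2_carrier: "j \<le> n \<Longrightarrow> u2 q a b s j + c \<cdot>\<^sub>m (vv q j * s 0) \<in> carrier_mat (Suc j * q) q"
  unfolding u2_def using block_mat_carrier[of q "j + 1" 1] vv_carrier[of j] s_dim[of 0]
  by (intro add_carrier_mat smult_carrier_mat) (simp add: mult_carrier_mat)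

text \<open>With \<open>D_y_Suc\<close> this meets the hypotheses of \<open>blk_Rm_mult\<close>: the
  resolvent at \<open>c\<close> sends this vector to the blocks of
  \<open>D (scal a) (y c)\<close>.\<close>

lemma blk_w2:
  assumes j: "j \<le> n" and l: "l \<le> j"
  shows "blk q (u2 q a b s j + c \<cdot>\<^sub>m (vv q j * s 0)) l 0
    = (if l = 0 then D (scal a) (y c) 0 else - D (scal a) rho (l - 1))"
proof -
  have u: "u2 q a b s j \<in> carrier_mat (Suc j * q) (1 * q)"
    unfolding u2_def using block_mat_carrier[of q "j + 1" 1] by simp
  have v: "vv q j \<in> carrier_mat (Suc j * q) (1 * q)" using vv_carrier by simp
  have s0: "s 0 \<in> carrier_mat (1 * q) (1 * q)" using s_dim[of 0] by simp
  have vs: "vv q j * s 0 \<in> carrier_mat (Suc j * q) (1 * q)" using v s0 by simp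
  have l': "l < Suc j" using l by simp
  have "blk q (vv q j * s 0) l 0 = blk q (vv q j) l 0 * S 0"
    using blk_mult[OF q v s0 l', of 0] by (simp add: blk_s)
  moreover have "blk q (u2 q a b s j) l 0 = (if l = 0 then - scal (a + b) * S 0 + S 1 else - D (scal a) rho (l - 1))"
  proof (cases "l = 0")
    case True
    then show ?thesis unfolding u2_def using blk_block_mat[OF q, of l "j + 1" 0 1] s_dim[of 0] s_dim[of 1]
      by (simp add: u20_def blk1 blk_s scal_uminus scal_add scal_diff algebra_simps)
  next
    case False
    then have "l - 1 < 2 * n" using l j n by linarith
    with False l show ?thesis unfolding u2_def using blk_block_mat[OF q, of l "j + 1" 0 1]
      by (simp add: blk1 shat_carrier blk_shat rho'_eq)
  qed
  ultimately show ?thesis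
    using blk_add[OF q u smult_carrier_mat[OF vs] l', of 0 c] blk_smult[OF q vs l', of 0 c] blk_vv[OF l]
    by (simp add: D_y_0)
qed

lemma D_y_a: "D (scal a) (y a) = (\<lambda>i. - rho i)"
  by (simp add: D_D_hseq[OF central_scal])

text \<open>By \<open>D_y_a\<close> the resolvent vector is \<open>- rho\<close>, and the signs
  cancel in the quadratic form. The index rises by one because \<open>H2\<close> at \<open>j\<close>
  has \<open>j + 1\<close> block rows.\<close>

lemma blk_lam:
  assumes j: "j < n"
  shows "lam q a b s j \<in> carrier_mat q q" "blk q (lam q a b s j) 0 0 = E (Suc j) rho"
proof -
  let ?w = "u2 q a b s j + complex_of_real a \<cdot>\<^sub>m (vv q j * s 0)"
  have J: "minv (H2 q a b s j) \<in> carrier_mat (Suc j * q) (Suc j * q)"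
    using minv_inverse(1)[OF block_mat_carrier inv_shat, of "Suc j"] j by (simp add: H2_def)
  note k = blk_kernel_form[OF q w2_carrier J, where x = "\<lambda>i. - rho i" and z = "complex_of_real a"]
  have *: "lam q a b s j = mat_adjoint ?w * mat_adjoint (Rm q j a) * minv (H2 q a b s j) * Rm q j a * ?w"
    by (simp add: lam_def Let_def)
  have w0: "- rho 0 = blk q ?w 0 0"
    using blk_w2[of j 0 a] j fun_cong[OF D_y_a, of 0] by simp
  have wS: "- rho (Suc l) = scal a * - rho l + blk q ?w (Suc l) 0" if "l < j" for l
    using blk_w2[of j "Suc l" a] j that by (simp add: D_def)
  show "lam q a b s j \<in> carrier_mat q q" unfolding *
    by (rule k(1)) (use j w0 wS star_rho in \<open>auto simp: star_minus\<close>)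
  have "blk q (lam q a b s j) 0 0 = ker (blk q (minv (H2 q a b s j))) (Suc j) (\<lambda>i. - rho i) (\<lambda>i. - rho i)"
    unfolding * by (rule k(2)) (use j w0 wS star_rho in \<open>auto simp: star_minus\<close>)
  also have "\<dots> = E (Suc j) rho"
    unfolding E_def J2_eq by (simp add: ker_def sum_negf del: sum.lessThan_Suc)
  finally show "blk q (lam q a b s j) 0 0 = E (Suc j) rho" .
qed

lemma blk_mu:
  assumes j: "j \<le> n"
  shows "mu q a b s j \<in> carrier_mat q q" "blk q (mu q a b s j) 0 0 = F j (\<lambda>i. scal a ^ i)"
proof -
  have J: "minv (K1 q b s j) \<in> carrier_mat (Suc j * q) (Suc j * q)"
    using minv_inverse(1)[OF block_mat_carrier inv_Ka, of "Suc j"] j by (simp add: K1_def)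
  note k = blk_kernel_form[OF q vv_carrier J, where x = "\<lambda>i. scal a ^ i" and z = "complex_of_real a"]
  have *: "mu q a b s j = mat_adjoint (vv q j) * mat_adjoint (Rm q j a) * minv (K1 q b s j) * Rm q j a * vv q j"
    by (simp add: mu_def Let_def)
  show "mu q a b s j \<in> carrier_mat q q" unfolding *
    by (rule k(1)) (auto simp: blk_vv star_power star_scal)
  have "blk q (mu q a b s j) 0 0 = ker (blk q (minv (K1 q b s j))) (Suc j) (\<lambda>i. scal a ^ i) (\<lambda>i. scal a ^ i)"
    unfolding * by (rule k(2)) (auto simp: blk_vv star_power star_scal)
  then show "blk q (mu q a b s j) 0 0 = F j (\<lambda>i. scal a ^ i)"
    unfolding F_def J1_eq .
qed

lemma blk_mbold:
  assumes k: "k \<le> n"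
  shows "mbold q a b s k \<in> carrier_mat q q" "blk q (mbold q a b s k) 0 0 = mm k"
proof -
  have "mbold q a b s k \<in> carrier_mat q q \<and> blk q (mbold q a b s k) 0 0 = mm k"
  proof (cases k)
    case 0
    then show ?thesis using blk_mu[of 0] by (simp add: mm_def)
  next
    case (Suc j)
    then show ?thesis using blk_mu[of j] blk_mu[of "Suc j"] k
      by (simp add: mm_def blk1_diff minus_carrier_mat)
  qed
  then show "mbold q a b s k \<in> carrier_mat q q" "blk q (mbold q a b s k) 0 0 = mm k" by auto
qed

lemma blk_lshift:
  assumes k: "k \<le> n"
  shows "lshift q a b s k \<in> carrier_mat q q" "blk q (lshift q a b s k) 0 0 = ll k"
proof -
  have E0: "E 0 rho = 0" by (simp add: E_def ker_def)
  consider "k = 0" | "k = Suc 0" | j where "k = Suc (Suc j)"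
    by (metis not0_implies_Suc)
  then have "lshift q a b s k \<in> carrier_mat q q \<and> blk q (lshift q a b s k) 0 0 = ll k"
  proof cases
    case 1
    then show ?thesis using s_dim[of 0] blk_s[of 0] by (simp add: ll_def)
  next
    case 2
    then show ?thesis using blk_lam[of 0] k E0 by (simp add: ll_def)
  next
    case (3 j)
    then show ?thesis using blk_lam[of j] blk_lam[of "Suc j"] k
      by (simp add: ll_def blk1_diff minus_carrier_mat)
  qed
  then show "lshift q a b s k \<in> carrier_mat q q" "blk q (lshift q a b s k) 0 0 = ll k" by auto
qed

lemma blk_P2: "P2 q a b s n c \<in> carrier_mat q q"
  "blk q (P2 q a b s n c) 0 0 = OP (D (scal a) rho) (J2 n) n (\<lambda>i. scal c ^ i)"
proof -
  have *: "P2 q a b s n c = hcat (- (mat_adjoint (block_mat q n 1 (\<lambda>l k. shat a b s (n + l)))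
      * minv (block_mat q n n (\<lambda>l i. shat a b s (l + i))))) (1\<^sub>m q) * Rm q n c * vv q n"
    using n by (simp add: P2_def Y2_def H2_def)
  note k = blk_orthogonal_poly[OF q vv_carrier inv_shat[OF order_refl], where \<kappa> = "D (scal a) rho"
      and x = "\<lambda>i. scal c ^ i" and z = c]
  show "P2 q a b s n c \<in> carrier_mat q q"
    unfolding * by (rule k(1)) (auto simp: blk_vv blk_shat rho'_eq star_D_rho)
  show "blk q (P2 q a b s n c) 0 0 = OP (D (scal a) rho) (J2 n) n (\<lambda>i. scal c ^ i)"
    unfolding * J2_def by (rule k(2)) (auto simp: blk_vv blk_shat rho'_eq star_D_rho)
qed

lemma blk_Q2: "Q2 q a b s n c \<in> carrier_mat q q"
  "blk q (Q2 q a b s n c) 0 0 = - OP (D (scal a) rho) (J2 n) n (D (scal a) (y c))"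
proof -
  let ?p = "hcat (- (mat_adjoint (block_mat q n 1 (\<lambda>l k. shat a b s (n + l)))
      * minv (block_mat q n n (\<lambda>l i. shat a b s (l + i))))) (1\<^sub>m q) * Rm q n c
      * (u2 q a b s n + c \<cdot>\<^sub>m (vv q n * s 0))"
  have *: "Q2 q a b s n c = - ?p"
    using n by (simp add: Q2_def Y2_def H2_def)
  note k = blk_orthogonal_poly[OF q w2_carrier[OF order_refl] inv_shat[OF order_refl],
      where \<kappa> = "D (scal a) rho" and x = "D (scal a) (y c)" and z = c]
  have 1: "?p \<in> carrier_mat q q"
    by (rule k(1)) (auto simp: blk_w2 D_y_Suc blk_shat rho'_eq star_D_rho)
  then show "Q2 q a b s n c \<in> carrier_mat q q" unfolding * by simp
  have "blk q ?p 0 0 = OP (D (scal a) rho) (J2 n) n (D (scal a) (y c))"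
    unfolding J2_def by (rule k(2)) (auto simp: blk_w2 D_y_Suc blk_shat rho'_eq star_D_rho)
  then show "blk q (Q2 q a b s n c) 0 0 = - OP (D (scal a) rho) (J2 n) n (D (scal a) (y c))"
    unfolding * using 1 by (simp add: blk1)
qed

lemma blk_Gamma1: "Gamma1 q b s n c \<in> carrier_mat q q"
  "blk q (Gamma1 q b s n c) 0 0 = OP rho (J1 n) n (\<lambda>i. scal c ^ i)"
proof -
  have *: "Gamma1 q b s n c = hcat (- (mat_adjoint (block_mat q n 1 (\<lambda>l k. Ka (n + l)))
      * minv (block_mat q n n (\<lambda>l i. Ka (l + i))))) (1\<^sub>m q) * Rm q n c * vv q n"
    using n by (simp add: Gamma1_def Yt1_def K1_def)
  note k = blk_orthogonal_poly[OF q vv_carrier inv_Ka, of n, where \<kappa> = rho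
      and x = "\<lambda>i. scal c ^ i" and z = c]
  show "Gamma1 q b s n c \<in> carrier_mat q q"
    unfolding * by (rule k(1)) (auto simp: blk_vv blk_Ka[simplified] rho'_eq star_rho)
  show "blk q (Gamma1 q b s n c) 0 0 = OP rho (J1 n) n (\<lambda>i. scal c ^ i)"
    unfolding * J1_def by (rule k(2)) (auto simp: blk_vv blk_Ka[simplified] rho'_eq star_rho)
qed

lemma blk_Theta1: "Theta1 q b s n c \<in> carrier_mat q q"
  "blk q (Theta1 q b s n c) 0 0 = OP rho (J1 n) n (y c)"
proof -
  have w: "ut1 q b s n \<in> carrier_mat (Suc n * q) q"
    unfolding ut1_def using block_mat_carrier[of q "n + 1" 1] by simp
  have bw: "blk q (ut1 q b s n) l 0 = (if l = 0 then S 0 else - rho (l - 1))" if l: "l \<le> n" for l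
    unfolding ut1_def using blk_block_mat[OF q, of l "n + 1" 0 1] l s_dim[of l] s_dim[of "l - 1"]
    by (auto simp: blk1 blk_s rho_def)
  have *: "Theta1 q b s n c = hcat (- (mat_adjoint (block_mat q n 1 (\<lambda>l k. Ka (n + l)))
      * minv (block_mat q n n (\<lambda>l i. Ka (l + i))))) (1\<^sub>m q) * Rm q n c * ut1 q b s n"
    using n by (simp add: Theta1_def Yt1_def K1_def)
  have yS: "y c (Suc i) = scal c * y c i - rho i" for i
    using fun_cong[OF D_D_hseq[OF central_scal, of c], of i] by (simp add: D_def algebra_simps)
  have y0: "y c 0 = S 0" by (simp add: D_def)
  note k = blk_orthogonal_poly[OF q w inv_Ka, where \<kappa> = rho and x = "y c" and z = c]
  show "Theta1 q b s n c \<in> carrier_mat q q"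
    unfolding * by (rule k(1)) (auto simp: bw y0 yS blk_Ka[simplified] rho'_eq star_rho)
  show "blk q (Theta1 q b s n c) 0 0 = OP rho (J1 n) n (y c)"
    unfolding * J1_def by (rule k(2)) (auto simp: bw y0 yS blk_Ka[simplified] rho'_eq star_rho)
qed

definition JS where "JS = blk q (minv (block_mat q (Suc n) (Suc n) (\<lambda>l i. s (l + i))))"

lemma blk_P1: "P1 q s (Suc n) c \<in> carrier_mat q q"
  "blk q (P1 q s (Suc n) c) 0 0 = OP S JS (Suc n) (\<lambda>i. scal c ^ i)"
proof -
  have *: "P1 q s (Suc n) c = hcat (- (mat_adjoint (block_mat q (Suc n) 1 (\<lambda>l k. s (Suc n + l)))
      * minv (block_mat q (Suc n) (Suc n) (\<lambda>l i. s (l + i))))) (1\<^sub>m q) * Rm q (Suc n) c * vv q (Suc n)"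
    by (simp add: P1_def Y1_def H1_def)
  note k = blk_orthogonal_poly[OF q vv_carrier inv_s[OF order_refl], where \<kappa> = S
      and x = "\<lambda>i. scal c ^ i" and z = c]
  show "P1 q s (Suc n) c \<in> carrier_mat q q"
    unfolding * by (rule k(1)) (auto simp: blk_vv blk_s star_S)
  show "blk q (P1 q s (Suc n) c) 0 0 = OP S JS (Suc n) (\<lambda>i. scal c ^ i)"
    unfolding * JS_def by (rule k(2)) (auto simp: blk_vv blk_s star_S)
qed

text \<open>The blocks of \<open>u1\<close> carry minus signs, so the resolvent yields
  \<open>- hseq\<close>; the outer minus of \<open>Q1\<close> cancels it.\<close>

lemma blk_Q1: "Q1 q s (Suc n) c \<in> carrier_mat q q"
  "blk q (Q1 q s (Suc n) c) 0 0 = OP S JS (Suc n) (hseq S (scal c))"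
proof -
  let ?p = "hcat (- (mat_adjoint (block_mat q (Suc n) 1 (\<lambda>l k. s (Suc n + l)))
      * minv (block_mat q (Suc n) (Suc n) (\<lambda>l i. s (l + i))))) (1\<^sub>m q) * Rm q (Suc n) c * u1 q s (Suc n)"
  have w: "u1 q s (Suc n) \<in> carrier_mat (Suc (Suc n) * q) q"
    unfolding u1_def using block_mat_carrier[of q "Suc n + 1" 1] by simp
  have bw: "blk q (u1 q s (Suc n)) l 0 = (if l = 0 then 0 else - S (l - 1))" if l: "l \<le> Suc n" for l
    unfolding u1_def using blk_block_mat[OF q, of l "Suc n + 1" 0 1] l s_dim[of "l - 1"]
    by (auto simp: blk1 blk_s)
  have *: "Q1 q s (Suc n) c = - ?p"
    by (simp add: Q1_def Y1_def H1_def)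
  note k = blk_orthogonal_poly[OF q w inv_s[OF order_refl], where \<kappa> = S
      and x = "\<lambda>i. - hseq S (scal c) i" and z = c]
  have 1: "?p \<in> carrier_mat q q"
    by (rule k(1)) (auto simp: bw blk_s star_S)
  then show "Q1 q s (Suc n) c \<in> carrier_mat q q" unfolding * by simp
  have "blk q ?p 0 0 = OP S JS (Suc n) (\<lambda>i. - hseq S (scal c) i)"
    unfolding JS_def by (rule k(2)) (auto simp: bw blk_s star_S)
  then show "blk q (Q1 q s (Suc n) c) 0 0 = OP S JS (Suc n) (hseq S (scal c))"
    unfolding * using 1 by (simp add: blk1 lin_minus_arg[OF lin_OP])
qed

lemma hinv_JS: "hinv S (Suc n) JS"
  unfolding JS_def by (rule hinv_blk_minv[OF q inv_s]) (auto simp: blk_s)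

end

section \<open>Assembly of the two-by-two factorisation\<close>

context hausdorff_moments
begin

lemma double_carrier: "A \<in> carrier_mat q q \<Longrightarrow> L \<in> carrier_mat q q \<Longrightarrow>
    four_block_mat A B C L \<in> carrier_mat (2 * q) (2 * q)"
  using four_block_carrier_mat[of A q q L q q B C] by (simp add: mult_2)

lemma blk_mult_double:
  assumes "A \<in> carrier_mat (2 * q) (2 * q)" "B \<in> carrier_mat (2 * q) (2 * q)" "i < 2" "j < 2"
  shows "blk q (A * B) i j = blk q A i 0 * blk q B 0 j + blk q A i (Suc 0) * blk q B (Suc 0) j"
  using blk_mult[OF q assms] by (simp add: numeral_2_eq_2)

lemmas double_simps = blk_mult_double double_carrier mult_carrier_mat[of _ "2 * q" "2 * q"]
  blk_four_block[OF q]

context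
  fixes z :: complex
begin

abbreviation w where "w \<equiv> scal (cnj z)"

lemma star_w: "scal z = star w"
  by (simp add: star_scal)

definition factor :: "nat \<Rightarrow> complex mat" where
  "factor k = blk2 (1\<^sub>m q) (lshift q a b s k) (0\<^sub>m q q) (1\<^sub>m q)
           * blk2 (1\<^sub>m q) (0\<^sub>m q q) (- (z - of_real a) \<cdot>\<^sub>m mbold q a b s k) (1\<^sub>m q)"

lemma factor_carrier: "factor k \<in> carrier_mat (2 * q) (2 * q)"
  unfolding factor_def by (intro mult_carrier_mat[of _ "2 * q" "2 * q"] double_carrier) auto

lemma blk_factor:
  assumes k: "k \<le> n"
  shows "blk q (factor k) 0 0 = 1 - (scal z - scal a) * ll k * mm k"
    "blk q (factor k) 0 (Suc 0) = ll k"
    "blk q (factor k) (Suc 0) 0 = - (scal z - scal a) * mm k"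
    "blk q (factor k) (Suc 0) (Suc 0) = 1"
proof -
  have c: "- (z - of_real a) \<cdot>\<^sub>m mbold q a b s k \<in> carrier_mat q q"
    using blk_mbold(1)[OF k] by simp
  have t: "blk q (- (z - of_real a) \<cdot>\<^sub>m mbold q a b s k) 0 0 = - (scal z - scal a) * mm k"
    unfolding blk1_smult[OF blk_mbold(1)[OF k]] blk_mbold(2)[OF k] scal_uminus scal_diff ..
  have e: "ll k * (- (scal z - scal a) * mm k) = - ((scal z - scal a) * ll k * mm k)"
    by (simp add: central_left_commute[OF central_diff[OF central_scal central_scal]] mult.assoc
        del: minus_diff_eq)
  note simps = factor_def double_simps blk_lshift[OF k] c t e blk1_one blk1_zero
  show "blk q (factor k) 0 0 = 1 - (scal z - scal a) * ll k * mm k"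
    "blk q (factor k) 0 (Suc 0) = ll k"
    "blk q (factor k) (Suc 0) 0 = - (scal z - scal a) * mm k"
    "blk q (factor k) (Suc 0) (Suc 0) = 1"
    by (simp_all add: simps del: minus_diff_eq mult_minus_left)
qed

lemma blk_ordprod:
  assumes "k \<le> n"
  shows "blk q (ordprod (2 * q) factor k) 0 0 = M11 w k \<and>
    blk q (ordprod (2 * q) factor k) 0 (Suc 0) = M12 w k \<and>
    blk q (ordprod (2 * q) factor k) (Suc 0) 0 = M21 (scal z) w k \<and>
    blk q (ordprod (2 * q) factor k) (Suc 0) (Suc 0) = M22 w k"
  using assms
proof (induction k)
  case 0
  note M = M11_0[OF central_scal star_w] M12_0[OF central_scal star_w]
    M21_0[OF central_scal star_w] M22_0[OF central_scal star_w]
  have "ll 0 = S 0" by (simp add: ll_def)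
  then show ?case
    by (simp only: ordprod_0[of factor, OF factor_carrier] blk_factor[OF le0] M simp_thms)
next
  case (Suc k)
  let ?O = "ordprod (2 * q) factor k"
  let ?t = "scal z - scal a"
  note M = M11_Suc[OF central_scal star_w Suc.prems] M12_Suc[OF central_scal star_w Suc.prems]
    M21_Suc[OF central_scal star_w Suc.prems] M22_Suc[OF central_scal star_w Suc.prems]
  have O: "?O \<in> carrier_mat (2 * q) (2 * q)" by (rule ordprod_carrier[OF factor_carrier])
  \<comment> \<open>First-column entry of a row \<open>(x, r)\<close> times the next factor,
    regrouped so that the new second-column entry \<open>x * u + r\<close> appears as in
    \<open>M11_Suc\<close> and \<open>M21_Suc\<close>.\<close>
  have e: "x * (1 - ?t * u * v) + r * (- ?t * v) = x - ?t * (x * u + r) * v" for x u v r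
    by (simp only: right_diff_distrib mult_1_right mult.assoc distrib_left distrib_right mult_minus_left
        mult_minus_right central_left_commute[OF central_diff[OF central_scal central_scal]]
        diff_diff_add[symmetric] add_uminus_conv_diff)
  note IH = Suc.IH[OF Suc_leD[OF Suc.prems]]
  have "blk q (?O * factor (Suc k)) i j = blk q ?O i 0 * blk q (factor (Suc k)) 0 j
      + blk q ?O i (Suc 0) * blk q (factor (Suc k)) (Suc 0) j" if "i < 2" "j < 2" for i j
    by (rule blk_mult_double[OF O factor_carrier that])
  then show ?case
    unfolding ordprod_Suc[of factor, OF factor_carrier] M
    using IH by (simp add: blk_factor[OF Suc.prems] e del: minus_diff_eq mult_minus_left)
qed

lemma resolvent_factorization:
  assumes zb: "z \<noteq> of_real b"
  shows "U_odd q n a b s z =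
      blk2 ((1 / (of_real b - z)) \<cdot>\<^sub>m 1\<^sub>m q) (0\<^sub>m q q) (0\<^sub>m q q) (1\<^sub>m q)
    * ordprod (2 * q) factor n
    * blk2 (1\<^sub>m q)
        (- (minv (Gamma1 q b s n (of_real a)) * Theta1 q b s n (of_real a))
         - of_real (b - a) \<cdot>\<^sub>m (minv (P1 q s (n + 1) (of_real a)) * Q1 q s (n + 1) (of_real a)))
        (0\<^sub>m q q) (1\<^sub>m q)
    * blk2 ((of_real b - z) \<cdot>\<^sub>m 1\<^sub>m q) (0\<^sub>m q q) (0\<^sub>m q q) (1\<^sub>m q)" (is "_ = ?B1 * ?O * ?B2 * ?B3")
proof -
  let ?d = "blk q (minv (P1 q s (Suc n) (of_real a))) 0 0"
  \<comment> \<open>Normalising the orthogonal polynomial by the inverse of \<open>P1\<close> at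
    \<open>a\<close> meets the hypotheses on \<open>N\<close>; this is where invertibility of
    \<open>P1\<close> at \<open>a\<close> enters.\<close>
  define N where "N = (\<lambda>x. ?d * OP S JS (Suc n) x)"
  have invP: "invertible_mat (P1 q s (Suc n) (of_real a))" using P1a by simp
  note mP = minv_inverse[OF blk_P1(1) invP]
  have dP: "?d * blk q (P1 q s (Suc n) (of_real a)) 0 0 = 1"
    unfolding blk1_mult[OF mP(1) blk_P1(1), symmetric] mP(3) by (rule blk1_one)
  have N: "lin (Suc (Suc n)) N" unfolding N_def by (intro lin_mult lin_OP)
  have N1: "N (\<lambda>i. scal a ^ i) = 1" using dP by (simp add: N_def blk_P1)
  have No: "N (\<lambda>i. S (l + i)) = 0" if "l \<le> n" for l
    using OP_orth[OF hinv_JS, of l] that by (simp add: N_def)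
  obtain c where c: "\<And>x. F n x = c * OP (D (scal a) rho) (J2 n) n x"
    and c1: "c * OP (D (scal a) rho) (J2 n) n rho = 1"
    using F_eq_mult_OP[of n] by auto
  obtain g where g: "\<And>x. G n x = g * OP rho (J1 n) n x"
    and g1: "g * OP rho (J1 n) n (\<lambda>i. scal a ^ i) = 1"
    using G_eq_mult_OP[of n] by auto

  let ?X = "- (minv (Gamma1 q b s n (of_real a)) * Theta1 q b s n (of_real a))
         - of_real (b - a) \<cdot>\<^sub>m (minv (P1 q s (n + 1) (of_real a)) * Q1 q s (n + 1) (of_real a))"
  have Gam: "invertible_mat (Gamma1 q b s n (of_real a))" "blk q (minv (Gamma1 q b s n (of_real a))) 0 0 = g"
    using blk_minv[OF q blk_Gamma1(1), of g "of_real a"] g1 by (simp_all add: blk_Gamma1)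
  note mG = minv_inverse[OF blk_Gamma1(1) Gam(1)]
  have XA: "minv (Gamma1 q b s n (of_real a)) * Theta1 q b s n (of_real a) \<in> carrier_mat q q"
    using mG(1) blk_Theta1(1) by (rule mult_carrier_mat)
  have XB: "minv (P1 q s (Suc n) (of_real a)) * Q1 q s (Suc n) (of_real a) \<in> carrier_mat q q"
    using mP(1) blk_Q1(1) by (rule mult_carrier_mat)
  have Xc: "?X \<in> carrier_mat q q" using XA XB by (simp add: minus_carrier_mat)
  have XN: "X N = - G n (y (of_real a)) - (scal b - scal a) * N (hseq S (scal a))"
    by (rule X_def[OF N N1 No])
  have Npow: "star (N (\<lambda>i. w ^ i)) = M21 (scal z) w n * X N + M22 w n"
    by (rule star_N_power[OF N N1 No central_scal star_w])
  have Nhs: "star (N (y (cnj z))) = M11 w n * X N + M12 w n"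
    by (rule star_N_hseq[OF N N1 No central_scal star_w])
  have NDhs: "N (y (cnj z)) = - (scal b - w) * N (hseq S w)"
    by (rule N_D_hseq[OF N N1 No central_scal])
  have blkX: "blk q ?X 0 0 = X N"
    using XA XB mG(1) mP(1) blk_Theta1(1) blk_Q1(1)
    unfolding XN
    by (simp add: blk1 blk_Theta1 blk_Q1 Gam N_def g scal_diff mult.assoc)

  have Q2a: "c * blk q (Q2 q a b s n (of_real a)) 0 0 = 1"
    using c1 unfolding blk_Q2 D_y_a lin_minus_arg[OF lin_OP] by simp
  \<comment> \<open>\<open>blk_minv\<close> makes the left inverse two-sided, so its adjoint is a
    left inverse of the adjoint matrix.\<close>
  have sQ: "star c * blk q (mat_adjoint (Q2 q a b s n (of_real a))) 0 0 = 1"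
    using blk_minv(3)[OF q blk_Q2(1) Q2a] unfolding blk1_adjoint[OF blk_Q2(1)]
    by (metis star_mult star_one)
  have aQ: "mat_adjoint (Q2 q a b s n (of_real a)) \<in> carrier_mat q q"
    by (rule mat_adjoint_carrier[OF blk_Q2(1)])
  note mQ = blk_minv[OF q aQ sQ]
  note mQc = minv_inverse(1)[OF aQ mQ(1)]
  have sP: "star ?d * blk q (mat_adjoint (P1 q s (Suc n) (of_real a))) 0 0 = 1"
    using blk_minv(3)[OF q blk_P1(1) dP] unfolding blk1_adjoint[OF blk_P1(1)]
    by (metis star_mult star_one)
  have aP: "mat_adjoint (P1 q s (Suc n) (of_real a)) \<in> carrier_mat q q"
    by (rule mat_adjoint_carrier[OF blk_P1(1)])
  note mPa = blk_minv[OF q aP sP]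
  note mPc = minv_inverse(1)[OF aP mPa(1)]

  have U11c: "adj_at (Q2 q a b s n) z * minv (mat_adjoint (Q2 q a b s n (of_real a))) \<in> carrier_mat q q"
    unfolding adj_at_def using mat_adjoint_carrier[OF blk_Q2(1)] mQc by (rule mult_carrier_mat)
  have U12c: "adj_at (Q1 q s (n + 1)) z * minv (mat_adjoint (P1 q s (n + 1) (of_real a))) \<in> carrier_mat q q"
    unfolding adj_at_def Suc_eq_plus1[symmetric]
    by (rule mult_carrier_mat[OF mat_adjoint_carrier[OF blk_Q1(1)] mPc])
  have U21c: "adj_at (P2 q a b s n) z * minv (mat_adjoint (Q2 q a b s n (of_real a))) \<in> carrier_mat q q"
    unfolding adj_at_def using mat_adjoint_carrier[OF blk_P2(1)] mQc by (rule mult_carrier_mat)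
  have U22c: "adj_at (P1 q s (n + 1)) z * minv (mat_adjoint (P1 q s (n + 1) (of_real a))) \<in> carrier_mat q q"
    unfolding adj_at_def Suc_eq_plus1[symmetric]
    by (rule mult_carrier_mat[OF mat_adjoint_carrier[OF blk_P1(1)] mPc])

  have U11: "blk q (adj_at (Q2 q a b s n) z * minv (mat_adjoint (Q2 q a b s n (of_real a)))) 0 0
      = M11 w n"
    using mQc by (simp add: adj_at_def blk1_mult blk1_adjoint mQ blk_Q2 mat_adjoint_carrier[OF blk_Q2(1)]
        M11_def[OF central_scal star_w] c star_mult star_minus)
  have U21: "blk q (adj_at (P2 q a b s n) z * minv (mat_adjoint (Q2 q a b s n (of_real a)))) 0 0
      = star (F n (\<lambda>i. w ^ i))"
    using mQc by (simp add: adj_at_def blk1_mult blk1_adjoint mQ blk_P2 mat_adjoint_carrier[OF blk_P2(1)]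
        c star_mult)
  have U12: "blk q (adj_at (Q1 q s (n + 1)) z * minv (mat_adjoint (P1 q s (n + 1) (of_real a)))) 0 0
      = star (N (hseq S w))"
    using mPc by (simp add: adj_at_def blk1_mult blk1_adjoint mPa blk_Q1 mat_adjoint_carrier[OF blk_Q1(1)]
        N_def star_mult)
  have U22: "blk q (adj_at (P1 q s (n + 1)) z * minv (mat_adjoint (P1 q s (n + 1) (of_real a)))) 0 0
      = M21 (scal z) w n * X N + M22 w n"
    unfolding Npow[symmetric]
    using mPc by (simp add: adj_at_def blk1_mult blk1_adjoint mPa blk_P1 mat_adjoint_carrier[OF blk_P1(1)]
        N_def star_mult)

  have inv1: "scal (1 / (of_real b - z)) * (scal (of_real b - z) * x) = x" for x
    using zb by (simp add: mult.assoc[symmetric] scal_mult[symmetric])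
  have inv2: "scal (of_real b - z) * (scal (1 / (of_real b - z)) * x) = x" for x
    using zb by (simp add: mult.assoc[symmetric] scal_mult[symmetric])
  \<comment> \<open>\<open>N_D_hseq\<close> contributes the factor \<open>b - z\<close>, which the
    leading diagonal matrix cancels in the upper right entry.\<close>
  have N12: "M11 w n * X N + M12 w n = - (scal (of_real b - z) * star (N (hseq S w)))"
  proof -
    have "star (scal b - w) = scal (of_real b - z)" by (simp add: star_diff star_scal scal_diff)
    then show ?thesis
      unfolding Nhs[symmetric] NDhs
      by (simp only: mult_minus_left star_minus star_mult centralD[OF central_scal])
  qed

  have sc: "blk q (t \<cdot>\<^sub>m 1\<^sub>m q) 0 0 = scal t" for t by (simp add: blk1)
  have cs: "x * scal t = scal t * x" for x t by (rule centralD[OF central_scal])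
  have U12c': "- (adj_at (Q1 q s (n + 1)) z * minv (mat_adjoint (P1 q s (n + 1) (of_real a)))) \<in> carrier_mat q q"
    using U12c by simp
  define M where "M = ?O"
  define B1 B2 B3 where B_defs: "B1 = ?B1" "B2 = ?B2" "B3 = ?B3"
  define L where "L = U_odd q n a b s z"
  have Mc: "M \<in> carrier_mat (2 * q) (2 * q)" unfolding M_def by (rule ordprod_carrier[OF factor_carrier])
  have Bc: "B1 \<in> carrier_mat (2 * q) (2 * q)" "B2 \<in> carrier_mat (2 * q) (2 * q)"
    "B3 \<in> carrier_mat (2 * q) (2 * q)" unfolding B_defs by (intro double_carrier; simp)+
  have Lc: "L \<in> carrier_mat (2 * q) (2 * q)"
    unfolding L_def U_odd_def by (intro double_carrier U11c U22c)
  note bs = blk_four_block[OF q smult_carrier_mat[OF one_carrier_mat] zero_carrier_mat zero_carrier_mat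
      one_carrier_mat, unfolded sc blk1_one blk1_zero]
  note b1 = bs[of "1 / (of_real b - z)", folded B_defs]
  note b2 = blk_four_block[OF q one_carrier_mat Xc zero_carrier_mat one_carrier_mat,
      unfolded blk1_one blk1_zero blkX, folded B_defs]
  note b3 = bs[of "of_real b - z", folded B_defs]
  note m = blk_ordprod[OF order_refl, folded M_def]
  note u = blk_four_block[OF q U11c U12c' smult_carrier_mat[OF U21c, of "- ((z - of_real a) * (of_real b - z))"]
      U22c, folded U_odd_def L_def,
      unfolded blk1_uminus[OF U12c] blk1_smult[OF U21c] U11 U12 U21 U22]
  have B12: "B1 * M \<in> carrier_mat (2 * q) (2 * q)" "B1 * M * B2 \<in> carrier_mat (2 * q) (2 * q)"
    using Bc Mc by (metis mult_carrier_mat)+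
  note R = blk_mult_double[OF B12(2) Bc(3)] blk_mult_double[OF B12(1) Bc(2)] blk_mult_double[OF Bc(1) Mc]
    b1 b2 b3 m
  have "L = B1 * M * B2 * B3"
  proof (rule mat_eq_blkI[OF Lc])
    show "B1 * M * B2 * B3 \<in> carrier_mat (2 * q) (2 * q)"
      using B12(2) Bc(3) by (rule mult_carrier_mat)
    have 00: "blk q L 0 0 = blk q (B1 * M * B2 * B3) 0 0"
      by (simp add: R u cs inv2 mult.assoc)
    have 01: "blk q L 0 (Suc 0) = blk q (B1 * M * B2 * B3) 0 (Suc 0)"
    proof -
      have "scal (1 / (of_real b - z)) * (M11 w n * X N + M12 w n) = - star (N (hseq S w))"
        unfolding N12 by (simp add: inv1)
      then show ?thesis by (simp add: R u distrib_left mult.assoc)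
    qed
    \<comment> \<open>Here the trailing diagonal matrix supplies the factor \<open>b - z\<close>
      that \<open>M21\<close> lacks.\<close>
    have 10: "blk q L (Suc 0) 0 = blk q (B1 * M * B2 * B3) (Suc 0) 0"
    proof -
      have "scal (- ((z - of_real a) * (of_real b - z))) = - (scal (of_real b - z) * (scal z - scal a))"
        by (simp only: scal_uminus scal_mult scal_diff mult.commute[of "z - of_real a"])
      then show ?thesis
        by (simp add: R u M21_def[OF central_scal star_w] cs mult.assoc del: minus_diff_eq)
    qed
    have 11: "blk q L (Suc 0) (Suc 0) = blk q (B1 * M * B2 * B3) (Suc 0) (Suc 0)"
      by (simp add: R u)
    fix i j :: nat assume "i < 2" "j < 2"
    then have "i = 0 \<or> i = Suc 0" "j = 0 \<or> j = Suc 0" by auto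
    then show "blk q L i j = blk q (B1 * M * B2 * B3) i j"
      using 00 01 10 11 by blast
  qed
  then show ?thesis unfolding L_def M_def B_defs .
qed

end

end

theorem mainTheorem7:
  fixes q n :: nat and a b :: real and s :: "nat \<Rightarrow> complex mat"
  assumes "1 \<le> q" and "1 \<le> n" and "a < b"
    and s_dim: "\<And>j. j \<le> 2 * n + 1 \<Longrightarrow> s j \<in> carrier_mat q q"
    and s_herm: "\<And>j. j \<le> 2 * n + 1 \<Longrightarrow> hermitian (s j)"
    and "pos_def (H1 q s n)" and "pos_def (H2 q a b s (n - 1))"
    and "pos_def (K1 q b s n)" and "pos_def (K2 q a s n)"
    and "invertible_mat (P1 q s (n + 1) (of_real a))"
  shows "\<forall>z :: complex. z \<noteq> of_real b \<longrightarrow>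
    U_odd q n a b s z =
      blk2 ((1 / (of_real b - z)) \<cdot>\<^sub>m 1\<^sub>m q) (0\<^sub>m q q) (0\<^sub>m q q) (1\<^sub>m q)
    * ordprod (2 * q)
        (\<lambda>k. blk2 (1\<^sub>m q) (lshift q a b s k) (0\<^sub>m q q) (1\<^sub>m q)
           * blk2 (1\<^sub>m q) (0\<^sub>m q q) (- (z - of_real a) \<cdot>\<^sub>m mbold q a b s k) (1\<^sub>m q)) n
    * blk2 (1\<^sub>m q)
        (- (minv (Gamma1 q b s n (of_real a)) * Theta1 q b s n (of_real a))
         - of_real (b - a) \<cdot>\<^sub>m (minv (P1 q s (n + 1) (of_real a)) * Q1 q s (n + 1) (of_real a)))
        (0\<^sub>m q q) (1\<^sub>m q)
    * blk2 ((of_real b - z) \<cdot>\<^sub>m 1\<^sub>m q) (0\<^sub>m q q) (0\<^sub>m q q) (1\<^sub>m q)"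
proof (intro allI impI)
  fix z :: complex
  assume z: "z \<noteq> of_real b"
  interpret hausdorff_moments q n a b s
    by unfold_locales (use assms in auto)
  show "U_odd q n a b s z =
      blk2 ((1 / (of_real b - z)) \<cdot>\<^sub>m 1\<^sub>m q) (0\<^sub>m q q) (0\<^sub>m q q) (1\<^sub>m q)
    * ordprod (2 * q)
        (\<lambda>k. blk2 (1\<^sub>m q) (lshift q a b s k) (0\<^sub>m q q) (1\<^sub>m q)
           * blk2 (1\<^sub>m q) (0\<^sub>m q q) (- (z - of_real a) \<cdot>\<^sub>m mbold q a b s k) (1\<^sub>m q)) n
    * blk2 (1\<^sub>m q)
        (- (minv (Gamma1 q b s n (of_real a)) * Theta1 q b s n (of_real a))
         - of_real (b - a) \<cdot>\<^sub>m (minv (P1 q s (n + 1) (of_real a)) * Q1 q s (n + 1) (of_real a)))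
        (0\<^sub>m q q) (1\<^sub>m q)
    * blk2 ((of_real b - z) \<cdot>\<^sub>m 1\<^sub>m q) (0\<^sub>m q q) (0\<^sub>m q q) (1\<^sub>m q)"
    using resolvent_factorization[OF z] unfolding factor_def[abs_def] .
qed

end
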